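(* Let $n\in\mathbb N_0$ and write $n=p\mathfrak r+\mathfrak l=qr+l$ with $0\le\mathfrak l<p$, $0\le l<q$. Let $B_N$ ($N\in\mathbb N_0$) be the monic step-line type-II mixed Piñeiro forms, $B_N=0$ for $N<0$, and let $b_n^k$ be the coefficients of $$xB_n(x)=\sum_{j=1}^q b_n^jB_{n+j}(x)+b_n^0B_n(x)+\sum_{i=1}^p b_n^{-i}B_{n-i}(x),$$ with $b_n^{-i}=0$ whenever $i>n$. Then, for $j\in\{1,\ldots,q\}$ and $1\le i\le\min(p,n)$, $$\begin{aligned}b_n^j={}&\frac{\widehat\kappa_{n+j}}{\widehat\kappa_n}\prod_{a=1}^p\frac{(\alpha_a+\beta_{l+1+j}+r+1+\mathfrak r)_{\lceil(\mathfrak l+j+2-a)/p\rceil}}{(\alpha_a+\beta_{l+1+j}+r+1+\mathfrak r)_{\lceil(\mathfrak l+j+1-a)/p\rceil}}\\&\times\sum_{k=j}^q\ \prod_{a=1}^{\mathfrak l}(\alpha_a+\beta_{k+l+1}+r)\prod_{a=1}^p\frac{(\alpha_{a+\mathfrak l}+\beta_{k+l+1}+r)_{\mathfrak r}}{(\alpha_a+\beta_{k+l+1}+r+1)_{\mathfrak r+\lceil(\mathfrak l+j+2-a)/p\rceil}}\cdot\frac{\prod_{h=1}^q(\beta_h-\beta_{k+l+1}-r)}{\prod_{h=j,\,h\ne k}^q(\beta_{h+l+1}-\beta_{k+l+1})},\end{aligned}$$ $$\begin{aligned}b_n^0={}&\prod_{h=1}^q\frac{\alpha_{\mathfrak l+1}+\beta_h+\mathfrak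 r+1}{\alpha_{\mathfrak l+1}+\beta_{l+1+h}+r+\mathfrak r+1}\prod_{a=1}^p\frac{\alpha_a-\alpha_{\mathfrak l+1}-\mathfrak r-1}{\alpha_{\mathfrak l+a}-\alpha_{\mathfrak l+1}-1}\\&+\sum_{k=1}^p\frac{\alpha_{\mathfrak l+1}+\beta_{l+1}+\mathfrak r+r+1}{(\alpha_{\mathfrak l+k}+\beta_{l+1}+\mathfrak r+r)(\alpha_{\mathfrak l+1}-\alpha_{\mathfrak l+k}+1)}\prod_{h=1}^q\frac{\alpha_{\mathfrak l+k}+\beta_h+\mathfrak r}{\alpha_{\mathfrak l+k}+\beta_{l+1+h}+\mathfrak r+r}\cdot\frac{\prod_{a=1}^p(\alpha_a-\alpha_{\mathfrak l+k}-\mathfrak r)}{\prod_{a=1,\,a\ne k}^p(\alpha_{\mathfrak l+a}-\alpha_{\mathfrak l+k})},\end{aligned}$$ $$\begin{aligned}b_n^{-i}={}&\frac{\widehat\kappa_{n-i}}{\widehat\kappa_n}\prod_{h=1}^q\frac{(\alpha_{p+\mathfrak l-i+1}+\beta_h+\mathfrak r+r)_{\lceil(l+2-i-h)/q\rceil}}{(\alpha_{p+\mathfrak l-i+1}+\beta_h+\mathfrak r+r)_{\lceil(l+1-i-h)/q\rceil}}\sum_{k=i}^p\ \prod_{h=1}^{l+1}\frac1{\alpha_{p+\mathfrak l-k+1}+\beta_h+\mathfrak r+1}\\&\times\frac{\displaystyle\prod_{h=1}^q\frac{(\alpha_{p+\mathfrak l-k+1}+\beta_h+\mathfrak r)_{r+\lceil(l+1-i-h)/q\rceil}}{(\alpha_{p+\mathfrak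 l-k+1}+\beta_{l+1+h}+\mathfrak r+1)_r}\ \prod_{a=1}^p(\alpha_a-\alpha_{p+\mathfrak l-k+1}-\mathfrak r)}{\displaystyle\prod_{a=i,\,a\ne k}^p(\alpha_{p+\mathfrak l-a+1}-\alpha_{p+\mathfrak l-k+1})}.\end{aligned}$$
   Context: $p,q\ge1$; real parameters satisfy $\alpha_i>-1$, $\beta_j>-1$, $\alpha_i+\beta_j>-1$ for all $1\le i\le p$, $1\le j\le q$; $\alpha_i-\alpha_h\notin\mathbb Z$ for $i\ne h$ and $\beta_j-\beta_s\notin\mathbb Z$ for $j\neq s$. Affine extension of indices: $\alpha_{sp+i}=\alpha_i+s$ ($1\le i\le p$), $\beta_{sq+j}=\beta_j+s$ ($1\le j\le q$), $s\in\mathbb N_0$. Pochhammer symbols: $(z)_0=1$, $(z)_n=\prod_{u=0}^{n-1}(z+u)$ and $(z)_{-n}=1/(z-n)_n$ for $n\in\mathbb N$. Where an expression is not directly defined (a factor $0/0$ cancels between numerator and denominator) its meromorphic continuation in the parameters after cancellation is used. For $N\in\mathbb N_0$ put $n_{i,N}=\lceil (N+1-i)/p\rceil$ ($1\le i\le p$) and $m_{j,N}=\lceil(N+2-j)/q\rceil$ ($1\le j\le q$), so $\sum_i n_{i,N}=N$, $\sum_jm_{j,N}=N+1$. The step-line type-II form is $B_N(x)=\sum_{j=1}^qB_N^{(j)}(x)x^{\beta_j}$, $\deg B_N^{(j)}\le m_{j,N}-1$ ($B_N^{(j)}\equiv0$ if $m_{j,N}=0$), satisfying $\int_0^1B_N(x)x^{k+\alpha_i}\,\mathrm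 dx=0$ for $0\le k\le n_{i,N}-1$, $1\le i\le p$, normalized so that the component $B_N^{(s_N)}$ is monic of degree $d_N$, where $s_N=(N\bmod q)+1$ and $d_N=\lfloor N/q\rfloor$ (so $m_{s_N,N}=d_N+1$). Put $$\widehat\kappa_N=\frac{\prod_{a=1}^p(\alpha_a+\beta_{s_N}+d_N+1)_{n_{a,N}}}{\prod_{1\le h\le q,\,h\ne s_N}(\beta_h-\beta_{s_N}-d_N)_{m_{h,N}}\;d_N!\,(-1)^{d_N}}$$ (this is the coefficient of $x^{d_N}$ in the $s_N$-th component of the contour-normalized form $\widehat B_N(x)=\int_\Sigma \frac{x^t\prod_i(t+\alpha_i+1)_{n_{i,N}}}{\prod_j(\beta_j-t)_{m_{j,N}}}\frac{\mathrm dt}{2\pi\mathrm i}$, $\Sigma$ clockwise around all points $\beta_j+k$, $0\le k\le m_{j,N}-1$; thus $B_N=\widehat B_N/\widehat\kappa_N$). *)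

theory Defs
  imports "HOL-Analysis.Analysis" "HOL-Computational_Algebra.Polynomial"
begin

text \<open>Pochhammer symbol with integer index: \<open>(z)\<^sub>-\<^sub>n = 1 / (z - n)\<^sub>n\<close> for \<open>n > 0\<close>.\<close>

definition ipochhammer :: "real \<Rightarrow> int \<Rightarrow> real" where
  "ipochhammer z k =
     (if k \<ge> 0 then pochhammer z (nat k)
      else 1 / pochhammer (z + of_int k) (nat (- k)))"

text \<open>
  The ceilings below are nonnegative for \<open>1 \<le> i \<le> p\<close> and \<open>1 \<le> j \<le> q\<close>, so that \<open>nat\<close> does
  not truncate.
\<close>

definition step_n :: "nat \<Rightarrow> nat \<Rightarrow> nat \<Rightarrow> nat" where
  "step_n p i N = nat \<lceil>(real N + 1 - real i) / real p\<rceil>"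

definition step_m :: "nat \<Rightarrow> nat \<Rightarrow> nat \<Rightarrow> nat" where
  "step_m q j N = nat \<lceil>(real N + 2 - real j) / real q\<rceil>"

definition step_s :: "nat \<Rightarrow> nat \<Rightarrow> nat" where
  "step_s q N = N mod q + 1"

definition step_d :: "nat \<Rightarrow> nat \<Rightarrow> nat" where
  "step_d q N = N div q"

text \<open>
  \<open>P j\<close> is the \<open>j\<close>-th polynomial component, \<open>1 \<le> j \<le> q\<close>; the form is considered for
  \<open>x > 0\<close>.
\<close>

definition mixed_form :: "nat \<Rightarrow> (nat \<Rightarrow> real) \<Rightarrow> (nat \<Rightarrow> real poly) \<Rightarrow> real \<Rightarrow> real" where
  "mixed_form q \<beta> P x = (\<Sum>j=1..q. poly (P j) x * x powr \<beta> j)"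

definition monic_stepline_form ::
  "nat \<Rightarrow> nat \<Rightarrow> (nat \<Rightarrow> real) \<Rightarrow> (nat \<Rightarrow> real) \<Rightarrow> nat \<Rightarrow> (nat \<Rightarrow> real poly) \<Rightarrow> bool" where
  "monic_stepline_form p q \<alpha> \<beta> N P \<longleftrightarrow>
     (\<forall>j\<in>{1..q}. if step_m q j N = 0 then P j = 0 else degree (P j) \<le> step_m q j N - 1) \<and>
     (\<forall>i\<in>{1..p}. \<forall>k<step_n p i N.
        ((\<lambda>x. mixed_form q \<beta> P x * x powr (real k + \<alpha> i)) has_integral 0) {0..1}) \<and>
     degree (P (step_s q N)) = step_d q N \<and> lead_coeff (P (step_s q N)) = 1"

definition kappa_hat :: "nat \<Rightarrow> nat \<Rightarrow> (nat \<Rightarrow> real) \<Rightarrow> (nat \<Rightarrow> real) \<Rightarrow> nat \<Rightarrow> real" where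
  "kappa_hat p q \<alpha> \<beta> N =
     (\<Prod>a=1..p. pochhammer (\<alpha> a + \<beta> (step_s q N) + real (step_d q N) + 1) (step_n p a N)) /
     ((\<Prod>h\<in>{1..q} - {step_s q N}.
          pochhammer (\<beta> h - \<beta> (step_s q N) - real (step_d q N)) (step_m q h N))
        * fact (step_d q N) * (-1) ^ step_d q N)"

text \<open>
  \<open>b k\<close>, \<open>-p \<le> k \<le> q\<close>, are the coefficients in the expansion of \<open>x B\<^sub>n(x)\<close>. The family \<open>B\<close>
  is indexed by integers, with \<open>B N = 0\<close> for \<open>N < 0\<close>.
\<close>

definition recurrence_coeffs ::
  "nat \<Rightarrow> nat \<Rightarrow> (nat \<Rightarrow> real) \<Rightarrow> (int \<Rightarrow> nat \<Rightarrow> real poly) \<Rightarrow> nat \<Rightarrow> (int \<Rightarrow> real) \<Rightarrow> bool" where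
  "recurrence_coeffs p q \<beta> B n b \<longleftrightarrow>
     (\<forall>x>0. x * mixed_form q \<beta> (B (int n)) x =
        (\<Sum>j=1..q. b (int j) * mixed_form q \<beta> (B (int n + int j)) x)
        + b 0 * mixed_form q \<beta> (B (int n)) x
        + (\<Sum>i=1..p. b (- int i) * mixed_form q \<beta> (B (int n - int i)) x)) \<and>
     (\<forall>i\<in>{1..p}. i > n \<longrightarrow> b (- int i) = 0)"

text \<open>
  A pitfall in the closed formula for \<open>b 0\<close>, whose singular expressions are to be read by
  cancellation: a denominator \<open>\<alpha> (\<ll> + k) + \<beta> h + \<rr> + r\<close> can vanish only if \<open>\<rr> = r = 0\<close> and
  \<open>\<ll> + k \<le> p\<close>. The \<open>k\<close>-th summand then contains the factor \<open>\<alpha> a - \<alpha> (\<ll> + k) - \<rr>\<close> with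
  \<open>a = \<ll> + k\<close>, which is identically \<open>0\<close> in the parameters. Its continuation is therefore \<open>0\<close>,
  and so is its value under \<open>x / 0 = 0\<close>. All other denominators in the closed formulas are
  nonzero.
\<close>

end

(*
  The Mellin transform of the monic form B_N over [0,1] is the rational function
    (-1)^N / kappa_N * prod_{i <= N} (s - alpha_i) / prod_{j <= N+1} (s + beta_j + 1),
  where alpha and beta are extended affinely: its poles are the exponents of B_N, its zeros are the
  orthogonality conditions, and its last residue is the normalization. Multiplication by x becomes
  s -> s + 1, so after clearing denominators the recurrence is the expansion of one explicit
  polynomial in the mixed Newton basis
    prod_{M < i <= N} (s - alpha_i) * prod_{N+2 <= j <= L+1} (s + beta_j + 1).
  A coefficient of such an expansion is a divided difference, taken either over the nodes alpha_i
  or over the nodes -beta_j - 1; the former gives b^0 and b^{-i}, the latter gives b^j.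
*)
theory Submission
  imports Defs
begin

text \<open>Each coefficient is a divided difference over either node family, and the two choices
  give sums of different lengths: with M = n - min p n, the index N uses N + 1 - M nodes \<alpha> or
  n + q + 1 - N nodes -\<beta> - 1. The second choice at N = n + j gives the q - j + 1 terms of b^j;
  the first at N = n - i gives, for n >= p, the p - i + 1 terms of b^{-i}. For n < p the window is
  cut off at N = 0 and fewer \<alpha> nodes exist, while the closed formulas keep their length. The
  surplus terms carry an identically zero factor, and the convention x / 0 = 0 has to be followed
  wherever their denominators vanish. The Mellin integrals converge only for large enough s, so an
  identity obtained there is extended as an identity of polynomials. Conversely, a finite
  combination of distinct powers with vanishing transform is zero. The recurrence is therefore
  equivalent to the polynomial expansion, which yields the existence of the coefficients as well as
  their values.\<close>

subsection \<open>Mixed Newton bases\<close>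


text \<open>The Lagrange interpolant \<open>sum G I\<close> coincides with \<open>h\<close>, since
  their difference has too many roots for its degree. The sum in question is the coefficient of the
  interpolant at exponent \<open>card I - 1\<close>, which exceeds the degree of
  \<open>h\<close>.\<close>

lemma divided_difference_eq_0:
  fixes x :: "'i \<Rightarrow> real"
  assumes "finite I" "inj_on x I" "degree h + 1 < card I"
  shows "(\<Sum>i\<in>I. poly h (x i) / (\<Prod>j\<in>I-{i}. x i - x j)) = 0"
proof -
  define G where "G i = smult (poly h (x i) / (\<Prod>j\<in>I-{i}. x i - x j)) (\<Prod>j\<in>I-{i}. [:- x j, 1:])" for i
  define D where "D = h - sum G I"
  have degp: "degree (\<Prod>j\<in>I-{i}. [:- x j, 1:]) = card I - 1" if "i \<in> I" for i
    using assms that by (subst degree_prod_eq_sum_degree) (auto simp: card_Diff_singleton)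
  have cf: "coeff (G i) (card I - 1) = poly h (x i) / (\<Prod>j\<in>I-{i}. x i - x j)" if "i \<in> I" for i
  proof -
    have "lead_coeff (\<Prod>j\<in>I-{i}. [:- x j, 1:]) = 1"
      by (subst lead_coeff_prod) simp
    then show ?thesis unfolding G_def using degp[OF that] by simp
  qed
  have dG: "degree (G i) < card I" if "i \<in> I" for i
  proof -
    have "degree (G i) \<le> card I - 1"
      unfolding G_def using degp[OF that] by simp
    then show ?thesis using assms(3) by linarith
  qed
  have "degree (sum G I) < card I"
    by (rule degree_sum_less) (use dG assms in auto)
  then have dD: "degree D < card I" unfolding D_def
    using assms(3) by (intro degree_diff_less) auto
  have ev: "poly D (x k) = 0" if "k \<in> I" for k
  proof -
    have z: "poly (G i) (x k) = 0" if "i \<in> I - {k}" for i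
      unfolding G_def poly_smult poly_prod using that \<open>k \<in> I\<close> assms(1)
      by (auto intro!: exI[of _ k])
    have nz: "(\<Prod>j\<in>I-{k}. x k - x j) \<noteq> 0"
      using assms that by (auto dest: inj_onD)
    have "poly (sum G I) (x k) = poly (G k) (x k) + (\<Sum>i\<in>I-{k}. poly (G i) (x k))"
      unfolding poly_sum by (rule sum.remove[OF assms(1) that])
    also have "\<dots> = poly (G k) (x k)" using z by simp
    also have "\<dots> = poly h (x k)" unfolding G_def poly_smult poly_prod using nz by simp
    finally show ?thesis by (simp add: D_def)
  qed
  have "D = 0"
  proof (rule ccontr)
    assume "D \<noteq> 0"
    have "card (x ` I) \<le> card {z. poly D z = 0}"
      by (rule card_mono) (use ev poly_roots_finite[OF \<open>D \<noteq> 0\<close>] in auto)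
    also have "\<dots> \<le> degree D" by (rule card_poly_roots_bound[OF \<open>D \<noteq> 0\<close>])
    finally show False using dD by (simp add: card_image[OF assms(2)])
  qed
  then have "coeff h (card I - 1) = (\<Sum>i\<in>I. coeff (G i) (card I - 1))"
    unfolding D_def by (simp add: coeff_sum)
  also have "\<dots> = (\<Sum>i\<in>I. poly h (x i) / (\<Prod>j\<in>I-{i}. x i - x j))"
    using cf by simp
  finally show ?thesis using assms(3) by (simp add: coeff_eq_0)
qed

text \<open>Common core of the two coefficient formulas below. Dividing by the weight
  \<open>w\<close> and taking the divided difference over the nodes kills every basis element except
  \<open>N0\<close>: it either vanishes at all nodes or becomes a polynomial of too low degree. The
  element \<open>N0\<close> survives at the single node \<open>i0\<close>.\<close>

lemma extract_coefficient:
  fixes x :: "'i \<Rightarrow> real" and e :: "'n \<Rightarrow> real"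
  assumes I: "finite I" "inj_on x I" "i0 \<in> I" and A: "finite A" "N0 \<in> A"
    and w: "\<And>i. i \<in> I \<Longrightarrow> w i \<noteq> 0"
    and f: "\<And>i. i \<in> I \<Longrightarrow> f i = (\<Sum>N\<in>A. e N * g N i)"
    and other: "\<And>N. N \<in> A - {N0} \<Longrightarrow> (\<forall>i\<in>I. g N i = 0) \<or>
                  (\<exists>h. degree h + 1 < card I \<and> (\<forall>i\<in>I. g N i = w i * poly h (x i)))"
    and g0: "\<And>i. i \<in> I - {i0} \<Longrightarrow> g N0 i = 0"
    and g1: "g N0 i0 = c * (\<Prod>j\<in>I-{i0}. x i0 - x j)"
  shows "(\<Sum>i\<in>I. f i / ((\<Prod>j\<in>I-{i}. x i - x j) * w i)) = e N0 * c / w i0"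
proof -
  let ?v = "\<lambda>i. (\<Prod>j\<in>I-{i}. x i - x j)"
  have nz: "?v i \<noteq> 0" if "i \<in> I" for i
    using I that by (auto dest: inj_onD)
  have "(\<Sum>i\<in>I. f i / (?v i * w i)) = (\<Sum>i\<in>I. \<Sum>N\<in>A. e N * (g N i / (?v i * w i)))"
    by (intro sum.cong refl) (simp add: f sum_divide_distrib)
  also have "\<dots> = (\<Sum>N\<in>A. \<Sum>i\<in>I. e N * (g N i / (?v i * w i)))"
    by (rule sum.swap)
  also have "\<dots> = (\<Sum>N\<in>A. e N * (\<Sum>i\<in>I. g N i / (?v i * w i)))"
    by (simp add: sum_distrib_left)
  also have "\<dots> = e N0 * (\<Sum>i\<in>I. g N0 i / (?v i * w i))"
  proof -
    have "(\<Sum>i\<in>I. g N i / (?v i * w i)) = 0" if N: "N \<in> A - {N0}" for N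
      using other[OF N]
    proof
      assume "\<exists>h. degree h + 1 < card I \<and> (\<forall>i\<in>I. g N i = w i * poly h (x i))"
      then obtain h where h: "degree h + 1 < card I" "\<forall>i\<in>I. g N i = w i * poly h (x i)" by blast
      have "(\<Sum>i\<in>I. g N i / (?v i * w i)) = (\<Sum>i\<in>I. poly h (x i) / ?v i)"
        by (intro sum.cong refl) (use h w in simp)
      then show ?thesis using divided_difference_eq_0[OF I(1,2) h(1)] by simp
    qed simp
    then show ?thesis using sum.remove[OF A, of "\<lambda>N. e N * (\<Sum>i\<in>I. g N i / (?v i * w i))"] by simp
  qed
  also have "(\<Sum>i\<in>I. g N0 i / (?v i * w i)) = g N0 i0 / (?v i0 * w i0)"
    using sum.remove[OF I(1,3), of "\<lambda>i. g N0 i / (?v i * w i)"] g0 by simp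
  also have "\<dots> = c / w i0" using nz[OF I(3)] by (simp add: g1)
  finally show ?thesis by simp
qed

lemma degree_prod_linear:
  fixes x :: "'i \<Rightarrow> real"
  shows "degree (\<Prod>i\<in>I. [:- x i, 1:]) = card I"
  by (cases "finite I") (auto simp: degree_prod_eq_sum_degree)

text \<open>At the nodes x_{M+1}, ..., x_{N0+1} the elements with N > N0 vanish, and those with N <
  N0 are divisible by the weight. The weight contains the factor j = N0 + 1, which the element
  \<open>N0\<close> itself lacks: it lowers the quotients for N < N0 to a degree that the divided
  difference annihilates. The price is the prefactor \<open>x (N0+1) - y (N0+1)\<close>.\<close>

lemma mixed_newton_coefficient_left:
  fixes x y :: "nat \<Rightarrow> real"
  assumes f: "\<And>s. f s = (\<Sum>N=M..L. e N * ((\<Prod>i=M+1..N. s - x i) * (\<Prod>j=N+2..L+1. s - y j)))"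
    and N0: "M \<le> N0" "N0 \<le> L" and inj: "inj_on x {M+1..N0+1}"
    and ne: "\<And>i j. i \<in> {M+1..N0+1} \<Longrightarrow> j \<in> {N0+1..L+1} \<Longrightarrow> x i \<noteq> y j"
  shows "e N0 = (x (N0+1) - y (N0+1)) * (\<Sum>i=M+1..N0+1. f (x i) /
     ((\<Prod>k\<in>{M+1..N0+1}-{i}. x i - x k) * (\<Prod>j=N0+1..L+1. x i - y j)))"
proof -
  let ?I = "{M+1..N0+1}"
  have w: "(\<Prod>j=N0+1..L+1. x i - y j) \<noteq> 0" if "i \<in> ?I" for i
    using ne[OF that] by auto
  have *: "(\<Sum>i\<in>?I. f (x i) / ((\<Prod>k\<in>?I-{i}. x i - x k) * (\<Prod>j=N0+1..L+1. x i - y j)))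
     = e N0 * (\<Prod>j=N0+2..L+1. x (N0+1) - y j) / (\<Prod>j=N0+1..L+1. x (N0+1) - y j)"
  proof (rule extract_coefficient[where A="{M..L}" and 
      g="\<lambda>N i. (\<Prod>k=M+1..N. x i - x k) * (\<Prod>j=N+2..L+1. x i - y j)"])
    fix N assume N: "N \<in> {M..L} - {N0}"
    show "(\<forall>i\<in>?I. (\<Prod>k=M+1..N. x i - x k) * (\<Prod>j=N+2..L+1. x i - y j) = 0) \<or>
      (\<exists>h. degree h + 1 < card ?I \<and> (\<forall>i\<in>?I. (\<Prod>k=M+1..N. x i - x k) * (\<Prod>j=N+2..L+1. x i - y j)
         = (\<Prod>j=N0+1..L+1. x i - y j) * poly h (x i)))"
    proof (cases "N0 < N")
      case True
      then have "\<forall>i\<in>?I. (\<Prod>k=M+1..N. x i - x k) = 0" by force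
      then show ?thesis by simp
    next
      case False
      with N have lt: "N < N0" "M \<le> N" by auto
      define h where "h = (\<Prod>k=M+1..N. [:- x k, 1:]) * (\<Prod>j=N+2..N0. [:- y j, 1:])"
      have "degree h \<le> (N - M) + (N0 - N - 1)" unfolding h_def
        by (rule order.trans[OF degree_mult_le]) (simp add: degree_prod_linear del: prod.cl_ivl_Suc)
      then have "degree h + 1 < card ?I" using lt by simp
      moreover have "(\<Prod>k=M+1..N. s - x k) * (\<Prod>j=N+2..L+1. s - y j)
         = (\<Prod>j=N0+1..L+1. s - y j) * poly h s" for s
      proof -
        have "(\<Prod>j=N+2..L+1. s - y j) = (\<Prod>j=N+2..N0. s - y j) * (\<Prod>j=N0+1..L+1. s - y j)"
          using prod.ub_add_nat[of "N+2" N0 "\<lambda>j. s - y j" "L+1-N0"] lt N0 by simp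
        then show ?thesis by (simp add: h_def poly_prod mult_ac del: prod.cl_ivl_Suc)
      qed
      ultimately show ?thesis by blast
    qed
  next
    fix i assume "i \<in> ?I - {N0+1}"
    then have "(\<Prod>k=M+1..N0. x i - x k) = 0" by force
    then show "(\<Prod>k=M+1..N0. x i - x k) * (\<Prod>j=N0+2..L+1. x i - y j) = 0" by simp
  next
    have "?I - {N0+1} = {M+1..N0}" by auto
    then show "(\<Prod>k=M+1..N0. x (N0+1) - x k) * (\<Prod>j=N0+2..L+1. x (N0+1) - y j) =
      (\<Prod>j=N0+2..L+1. x (N0+1) - y j) * (\<Prod>j\<in>?I - {N0+1}. x (N0+1) - x j)" by simp
  qed (use N0 inj w f in auto)
  have "(\<Prod>j=N0+1..L+1. x (N0+1) - y j) = (x (N0+1) - y (N0+1)) * (\<Prod>j=N0+2..L+1. x (N0+1) - y j)"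
    using N0 by (subst prod.atLeast_Suc_atMost) auto
  then show ?thesis unfolding * using w[of "N0+1"] N0 by auto
qed

text \<open>Mirror image of the previous lemma: over the nodes y the elements with N < N0 vanish,
  and those with N > N0 are divisible by the weight, which here has the additional factor i = N0 +
  1.\<close>

lemma mixed_newton_coefficient_right:
  fixes x y :: "nat \<Rightarrow> real"
  assumes f: "\<And>s. f s = (\<Sum>N=M..L. e N * ((\<Prod>i=M+1..N. s - x i) * (\<Prod>j=N+2..L+1. s - y j)))"
    and N0: "M \<le> N0" "N0 \<le> L" and inj: "inj_on y {N0+1..L+1}"
    and ne: "\<And>i j. i \<in> {M+1..N0+1} \<Longrightarrow> j \<in> {N0+1..L+1} \<Longrightarrow> x i \<noteq> y j"
  shows "e N0 = (y (N0+1) - x (N0+1)) * (\<Sum>j=N0+1..L+1. f (y j) /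
     ((\<Prod>k\<in>{N0+1..L+1}-{j}. y j - y k) * (\<Prod>i=M+1..N0+1. y j - x i)))"
proof -
  let ?I = "{N0+1..L+1}"
  have w: "(\<Prod>j=M+1..N0+1. y i - x j) \<noteq> 0" if "i \<in> ?I" for i
  proof -
    have "y i - x j \<noteq> 0" if "j \<in> {M+1..N0+1}" for j
      using ne[OF that \<open>i \<in> ?I\<close>] by simp
    then show ?thesis by (simp only: prod_zero_iff finite_atLeastAtMost) blast
  qed
  have *: "(\<Sum>i\<in>?I. f (y i) / ((\<Prod>k\<in>?I-{i}. y i - y k) * (\<Prod>j=M+1..N0+1. y i - x j)))
     = e N0 * (\<Prod>j=M+1..N0. y (N0+1) - x j) / (\<Prod>j=M+1..N0+1. y (N0+1) - x j)"
  proof (rule extract_coefficient[where A="{M..L}" and 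
      g="\<lambda>N i. (\<Prod>k=M+1..N. y i - x k) * (\<Prod>j=N+2..L+1. y i - y j)"])
    fix N assume N: "N \<in> {M..L} - {N0}"
    show "(\<forall>i\<in>?I. (\<Prod>k=M+1..N. y i - x k) * (\<Prod>j=N+2..L+1. y i - y j) = 0) \<or>
      (\<exists>h. degree h + 1 < card ?I \<and> (\<forall>i\<in>?I. (\<Prod>k=M+1..N. y i - x k) * (\<Prod>j=N+2..L+1. y i - y j)
         = (\<Prod>j=M+1..N0+1. y i - x j) * poly h (y i)))"
    proof (cases "N < N0")
      case True
      then have "(\<Prod>j=N+2..L+1. y i - y j) = 0" if "i \<in> ?I" for i
        by (intro prod_zero bexI[of _ i]) (use that in auto)
      then show ?thesis by simp
    next
      case False
      with N have lt: "N0 < N" "N \<le> L" by auto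
      define h where "h = (\<Prod>k=N0+2..N. [:- x k, 1:]) * (\<Prod>j=N+2..L+1. [:- y j, 1:])"
      have "degree h \<le> (N - N0 - 1) + (L - N)" unfolding h_def
        by (rule order.trans[OF degree_mult_le]) (simp add: degree_prod_linear del: prod.cl_ivl_Suc)
      then have "degree h + 1 < card ?I" using lt by simp
      moreover have "(\<Prod>k=M+1..N. s - x k) * (\<Prod>j=N+2..L+1. s - y j)
         = (\<Prod>j=M+1..N0+1. s - x j) * poly h s" for s
      proof -
        have "(\<Prod>k=M+1..N. s - x k) = (\<Prod>j=M+1..N0+1. s - x j) * (\<Prod>j=N0+2..N. s - x j)"
          using prod.ub_add_nat[of "M+1" "N0+1" "\<lambda>j. s - x j" "N-(N0+1)"] lt N0 by (simp del: prod.cl_ivl_Suc)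
        then show ?thesis by (simp add: h_def poly_prod mult_ac del: prod.cl_ivl_Suc)
      qed
      ultimately show ?thesis by blast
    qed
  next
    fix i assume "i \<in> ?I - {N0+1}"
    then have "(\<Prod>j=N0+2..L+1. y i - y j) = 0"
      by (intro prod_zero bexI[of _ i]) auto
    then show "(\<Prod>k=M+1..N0. y i - x k) * (\<Prod>j=N0+2..L+1. y i - y j) = 0" by simp
  next
    have "?I - {N0+1} = {N0+2..L+1}" by auto
    then show "(\<Prod>k=M+1..N0. y (N0+1) - x k) * (\<Prod>j=N0+2..L+1. y (N0+1) - y j) =
      (\<Prod>j=M+1..N0. y (N0+1) - x j) * (\<Prod>j\<in>?I - {N0+1}. y (N0+1) - y j)" by simp
  qed (use N0 inj w f in auto)
  have "(\<Prod>j=M+1..N0+1. y (N0+1) - x j) = (\<Prod>j=M+1..N0. y (N0+1) - x j) * (y (N0+1) - x (N0+1))"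
    using N0 by simp
  then show ?thesis unfolding * using w[of "N0+1"] N0 by auto
qed

text \<open>At \<open>x (M+1)\<close> only the basis element N = M, here \<open>g\<close>, is
  nonzero, so the value of \<open>f\<close> there fixes its coefficient. The remainder is divisible
  by the factor of \<open>x (M+1)\<close>, and the quotient is an instance with M replaced by M + 1.
  Separation of the x from the y keeps \<open>g\<close> nonzero at that point.\<close>

lemma mixed_newton_expansion:
  fixes x y :: "nat \<Rightarrow> real"
  assumes "degree f \<le> L - M" "M \<le> L"
    and "\<And>i j. i \<in> {M+1..L+1} \<Longrightarrow> j \<in> {M+1..L+1} \<Longrightarrow> x i \<noteq> y j"
  shows "\<exists>e. \<forall>s. poly f s = (\<Sum>N=M..L. e N * ((\<Prod>i=M+1..N. s - x i) * (\<Prod>j=N+2..L+1. s - y j)))"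
  using assms
proof (induction "L - M" arbitrary: M f)
  case 0
  then obtain c where "f = [:c:]" by (metis degree_eq_zeroE le_zero_eq)
  with 0 show ?case by (intro exI[of _ "\<lambda>_. c"]) simp
next
  case (Suc k)
  then have less: "M < L" by simp
  define g where "g = (\<Prod>j=M+2..L+1. [:- y j, 1:])"
  have gnz: "poly g (x (M+1)) \<noteq> 0"
    unfolding g_def poly_prod using Suc.prems(3) less by auto
  define c where "c = poly f (x (M+1)) / poly g (x (M+1))"
  have "poly (f - smult c g) (x (M+1)) = 0" using gnz by (simp add: c_def)
  then have "[:- x (M+1), 1:] dvd f - smult c g" by (simp only: poly_eq_0_iff_dvd)
  then obtain f' where f': "f - smult c g = [:- x (M+1), 1:] * f'" by (rule dvdE)
  have dg: "degree g = L - M" unfolding g_def degree_prod_linear by simp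
  have "degree (f - smult c g) \<le> L - M"
    by (rule degree_diff_le) (use Suc.prems dg degree_smult_le[of c g] in auto)
  then have df: "degree f' \<le> L - Suc M"
    unfolding f' by (cases "f' = 0") (auto simp: degree_mult_eq simp del: mult_pCons_left)
  have "\<exists>e. \<forall>s. poly f' s = (\<Sum>N=Suc M..L. e N * ((\<Prod>i=Suc M+1..N. s - x i) * (\<Prod>j=N+2..L+1. s - y j)))"
    by (rule Suc.hyps(1)) (use Suc.hyps(2) df less Suc.prems(3) in auto)
  then obtain e where e: "\<And>s. poly f' s = (\<Sum>N=Suc M..L. e N * ((\<Prod>i=Suc M+1..N. s - x i) * (\<Prod>j=N+2..L+1. s - y j)))"
    by blast
  show ?case
  proof (intro exI[of _ "e(M := c)"] allI)
    fix s
    have "poly f s = poly (smult c g + [:- x (M+1), 1:] * f') s"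
      using f' by (metis add.commute diff_add_cancel)
    also have "\<dots> = c * poly g s + (s - x (M+1)) * poly f' s" by (simp add: algebra_simps)
    also have "(s - x (M+1)) * poly f' s = (\<Sum>N=Suc M..L. e N * ((\<Prod>i=M+1..N. s - x i) * (\<Prod>j=N+2..L+1. s - y j)))"
      unfolding e sum_distrib_left
    proof (intro sum.cong refl)
      fix N assume "N \<in> {Suc M..L}"
      then have "(\<Prod>i=M+1..N. s - x i) = (s - x (M+1)) * (\<Prod>i=Suc M+1..N. s - x i)"
        by (subst prod.atLeast_Suc_atMost) auto
      then show "(s - x (M+1)) * (e N * ((\<Prod>i=Suc M+1..N. s - x i) * (\<Prod>j=N+2..L+1. s - y j)))
        = e N * ((\<Prod>i=M+1..N. s - x i) * (\<Prod>j=N+2..L+1. s - y j))" by simp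
    qed
    finally show "poly f s = (\<Sum>N=M..L. (e(M := c)) N * ((\<Prod>i=M+1..N. s - x i) * (\<Prod>j=N+2..L+1. s - y j)))"
      using less by (subst sum.atLeast_Suc_atMost) (auto simp: g_def poly_prod simp del: prod.cl_ivl_Suc)
  qed
qed

subsection \<open>Step-line multi-indices\<close>


text \<open>The pair (k, i) stands for the extended index k p + i, so \<open>step_n p i N\<close>
  counts the extended indices up to N that belong to residue class i. All later facts on the
  ceilings rest on this reading.\<close>

lemma less_step_n_iff:
  assumes "p \<ge> 1"
  shows "k < step_n p i N \<longleftrightarrow> k * p + i \<le> N"
proof -
  have "k < step_n p i N \<longleftrightarrow> real k < (real N + 1 - real i) / real p"
    by (simp add: step_n_def zless_nat_eq_int_zless less_ceiling_iff)
  also have "\<dots> \<longleftrightarrow> real k * real p < real N + 1 - real i"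
    using assms by (simp add: pos_less_divide_eq)
  also have "\<dots> \<longleftrightarrow> real (k * p + i) < real (N + 1)" by (simp add: algebra_simps)
  also have "\<dots> \<longleftrightarrow> k * p + i \<le> N" by (subst of_nat_less_iff) auto
  finally show ?thesis .
qed

lemma step_m_eq_step_n: "step_m q j N = step_n q j (Suc N)"
  by (simp add: step_m_def step_n_def algebra_simps)

lemma nat_eqI_less:
  fixes m n :: nat
  assumes "\<And>k. k < m \<longleftrightarrow> k < n"
  shows "m = n"
  using assms by (meson linorder_neqE_nat less_irrefl)

lemma step_n_last:
  assumes "p \<ge> 1"
  shows "step_n p (N mod p + 1) N = N div p"
proof (rule nat_eqI_less)
  fix k
  have "k * p + (N mod p + 1) \<le> N \<longleftrightarrow> k * p < N div p * p"
    using div_mult_mod_eq[of N p] by linarith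
  then show "k < step_n p (N mod p + 1) N \<longleftrightarrow> k < N div p"
    using assms by (simp add: less_step_n_iff)
qed

lemma step_n_Suc:
  assumes "p \<ge> 1" "a \<in> {1..p}"
  shows "step_n p a (Suc N) = step_n p a N + (if a = N mod p + 1 then 1 else 0)"
proof (cases "a = N mod p + 1")
  case True
  have "step_n p a (Suc N) = N div p + 1"
  proof (rule nat_eqI_less)
    fix k
    have "k * p + (N mod p + 1) \<le> Suc N \<longleftrightarrow> k * p \<le> N div p * p"
      using div_mult_mod_eq[of N p] by linarith
    then show "k < step_n p a (Suc N) \<longleftrightarrow> k < N div p + 1"
      using assms True by (auto simp: less_step_n_iff)
  qed
  with True show ?thesis using step_n_last[OF assms(1), of N] by simp
next
  case False
  have "step_n p a (Suc N) = step_n p a N"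
  proof (rule nat_eqI_less)
    fix k
    have "k * p + a \<noteq> Suc N"
    proof
      assume "k * p + a = Suc N"
      then have "N = (a - 1) + k * p" using assms by auto
      then have "N mod p = (a - 1) mod p" by simp
      then show False using False assms by (auto simp: mod_less)
    qed
    then show "k < step_n p a (Suc N) \<longleftrightarrow> k < step_n p a N"
      using assms by (auto simp: less_step_n_iff)
  qed
  with False show ?thesis by simp
qed

lemma step_n_0: "p \<ge> 1 \<Longrightarrow> a \<ge> 1 \<Longrightarrow> step_n p a 0 = 0"
  by (metis add_eq_0_iff_both_eq_0 le_zero_eq less_step_n_iff not_gr_zero not_one_le_zero)

lemma step_n_mult:
  assumes "p \<ge> 1" "a \<in> {1..p}"
  shows "step_n p a (p * r) = r"
proof (rule nat_eqI_less)
  fix k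
  have "k * p + a \<le> p * r \<longleftrightarrow> k < r"
  proof
    assume "k * p + a \<le> p * r"
    then have "k * p < p * r" using assms(2) unfolding atLeastAtMost_iff by linarith
    then show "k < r" by (simp add: mult.commute[of p r])
  next
    assume "k < r"
    then have "p * Suc k \<le> p * r" by (intro mult_le_mono) auto
    then show "k * p + a \<le> p * r" using assms by (simp add: mult.commute)
  qed
  then show "k < step_n p a (p * r) \<longleftrightarrow> k < r" using assms by (simp add: less_step_n_iff)
qed

text \<open>Matches the ceilings of the closed formulas, whose numerators involve only the remainder
  of n, with step counts at N: an integer r moves through the ceiling. The bound a <= p keeps the
  argument above -1, so \<open>nat\<close> loses nothing.\<close>

lemma ceiling_eq_step_n:
  assumes "p \<ge> 1" "a \<in> {1..p}" "e = real N + 1 - real a - real p * real r"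
  shows "int r + \<lceil>e / real p\<rceil> = int (step_n p a N)"
proof -
  have "e / real p + of_int (int r) = (real N + 1 - real a) / real p"
    using assms by (simp add: field_simps)
  then have "\<lceil>e / real p\<rceil> + int r = \<lceil>(real N + 1 - real a) / real p\<rceil>"
    by (metis ceiling_add_of_int)
  moreover have "\<lceil>(real N + 1 - real a) / real p\<rceil> \<ge> 0"
  proof -
    have "-1 < (real N + 1 - real a) / real p"
      using assms(1,2) by (simp add: field_simps)
    then show ?thesis by linarith
  qed
  ultimately show ?thesis by (simp add: step_n_def)
qed

text \<open>Covers both signs of \<open>c\<close>: a negative index removes factors from the end of
  the first r factors, a positive one appends factors to them.\<close>

lemma ipochhammer_eq_divide:
  assumes "z > 0" "int r + c = int k"
  shows "ipochhammer (z + real r) c = pochhammer z k / pochhammer z r"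
proof (cases "c \<ge> 0")
  case True
  then have "r \<le> k" "nat c = k - r" using assms by auto
  then show ?thesis using pochhammer_product[of r k z] pochhammer_pos[OF assms(1), of r] True
    by (simp add: ipochhammer_def)
next
  case False
  then have "k \<le> r" "nat (- c) = r - k" using assms by auto
  moreover have "z + real r + of_int c = z + real k"
    using assms(2) by (metis add.assoc of_int_add of_int_of_nat_eq)
  ultimately have "ipochhammer (z + real r) c = 1 / pochhammer (z + real k) (r - k)"
    using False by (simp only: ipochhammer_def if_False)
  then show ?thesis
    using pochhammer_product[OF \<open>k \<le> r\<close>, of z] pochhammer_pos[OF assms(1), of k] by simp
qed

text \<open>One-step form of the affine extension. It is inherited by the tails
  \<open>\<lambda>a. \<gamma> (c + a)\<close>, and it is the form in which a factor at s + 1 becomes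
  a factor at s with shifted index.\<close>

definition unit_shift :: "nat \<Rightarrow> (nat \<Rightarrow> real) \<Rightarrow> bool" where
  "unit_shift p \<gamma> \<longleftrightarrow> (\<forall>i\<ge>1. \<gamma> (i + p) = \<gamma> i + 1)"

lemma unit_shiftD: "unit_shift p \<gamma> \<Longrightarrow> i \<ge> 1 \<Longrightarrow> \<gamma> (i + p) = \<gamma> i + 1"
  by (simp add: unit_shift_def)

lemma affine_index:
  assumes "unit_shift p \<gamma>" "i \<ge> 1"
  shows "\<gamma> (s * p + i) = \<gamma> i + real s"
proof (induction s)
  case (Suc s)
  have "\<gamma> (Suc s * p + i) = \<gamma> ((s * p + i) + p)" by (simp add: algebra_simps)
  also have "\<dots> = \<gamma> i + real (Suc s)" using assms Suc by (simp add: unit_shiftD)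
  finally show ?case .
qed simp

lemma affine_index_mod_div:
  assumes "unit_shift p \<gamma>"
  shows "\<gamma> (Suc k) = \<gamma> (k mod p + 1) + real (k div p)"
  using affine_index[OF assms, of "k mod p + 1" "k div p"] by simp

text \<open>Passing from N to N + 1 lengthens exactly one Pochhammer symbol, the one of class N mod
  p, and its new last factor is the one with extended index N + 1. This turns every step-line
  product into a product over consecutive indices.\<close>

lemma prod_pochhammer_step_n:
  assumes p: "p \<ge> 1" and \<gamma>: "unit_shift p \<gamma>"
  shows "(\<Prod>a=1..p. pochhammer (\<gamma> a + z) (step_n p a N)) = (\<Prod>i=1..N. \<gamma> i + z)"
proof (induction N)
  case 0
  show ?case using p by (auto simp: step_n_0)
next
  case (Suc N)
  let ?c = "N mod p + 1"
  have c: "?c \<in> {1..p}" using p by (auto simp: Suc_leI)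
  have "(\<Prod>a=1..p. pochhammer (\<gamma> a + z) (step_n p a (Suc N)))
    = (\<Prod>a=1..p. pochhammer (\<gamma> a + z) (step_n p a N) * (if ?c = a then \<gamma> (Suc N) + z else 1))"
  proof (intro prod.cong refl)
    fix a assume "a \<in> {1..p}"
    then show "pochhammer (\<gamma> a + z) (step_n p a (Suc N))
      = pochhammer (\<gamma> a + z) (step_n p a N) * (if ?c = a then \<gamma> (Suc N) + z else 1)"
      using step_n_Suc[OF p, of a N] step_n_last[OF p, of N] affine_index_mod_div[OF \<gamma>, of N]
      by (auto simp: pochhammer_Suc algebra_simps)
  qed
  also have "\<dots> = (\<Prod>i=1..N. \<gamma> i + z) * (\<gamma> (Suc N) + z)"
    using c unfolding prod.distrib Suc by (subst prod.delta') auto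
  also have "\<dots> = (\<Prod>i=1..Suc N. \<gamma> i + z)" by simp
  finally show ?case .
qed

lemma kappa_hat_eq:
  assumes p: "p \<ge> 1" and q: "q \<ge> 1"
    and \<alpha>: "unit_shift p \<alpha>" and \<beta>: "unit_shift q \<beta>"
  shows "kappa_hat p q \<alpha> \<beta> N =
    (\<Prod>a=1..N. \<alpha> a + \<beta> (Suc N) + 1) / (\<Prod>h=1..N. \<beta> h - \<beta> (Suc N))"
proof -
  let ?s = "step_s q N" and ?d = "step_d q N"
  have b: "\<beta> (Suc N) = \<beta> ?s + real ?d"
    using affine_index_mod_div[OF \<beta>, of N] by (simp add: step_s_def step_d_def)
  have s: "?s \<in> {1..q}" using q by (auto simp: step_s_def Suc_leI)
  have num: "(\<Prod>a=1..p. pochhammer (\<alpha> a + \<beta> ?s + real ?d + 1) (step_n p a N))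
     = (\<Prod>a=1..N. \<alpha> a + \<beta> (Suc N) + 1)"
    using prod_pochhammer_step_n[OF p \<alpha>, of "\<beta> (Suc N) + 1" N] by (simp add: b add.assoc)
  have "(\<Prod>h\<in>{1..q}-{?s}. pochhammer (\<beta> h - \<beta> ?s - real ?d) (step_m q h N))
     = (\<Prod>h\<in>{1..q}-{?s}. pochhammer (\<beta> h - \<beta> (Suc N)) (step_n q h N))"
  proof (intro prod.cong refl)
    fix h assume h: "h \<in> {1..q}-{?s}"
    then have "step_m q h N = step_n q h N"
      using step_n_Suc[OF q, of h N] by (simp add: step_m_eq_step_n step_s_def)
    then show "pochhammer (\<beta> h - \<beta> ?s - real ?d) (step_m q h N)
      = pochhammer (\<beta> h - \<beta> (Suc N)) (step_n q h N)"
      by (simp add: b algebra_simps)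
  qed
  \<comment> \<open>The factors d! and (-1)^d in the definition of \<open>kappa_hat\<close> are the
    missing factor h = \<open>?s\<close>, namely (-d)_d, so the product becomes complete.\<close>
  moreover have "pochhammer (\<beta> ?s - \<beta> (Suc N)) (step_n q ?s N) = fact ?d * (-1) ^ ?d"
    using step_n_last[OF q, of N] pochhammer_same[of ?d, where 'a=real]
    by (simp add: b step_s_def step_d_def)
  ultimately have "(\<Prod>h\<in>{1..q}-{?s}. pochhammer (\<beta> h - \<beta> ?s - real ?d) (step_m q h N))
       * fact ?d * (-1) ^ ?d = (\<Prod>h=1..q. pochhammer (\<beta> h - \<beta> (Suc N)) (step_n q h N))"
    using s by (subst prod.remove[of _ ?s]) auto
  also have "\<dots> = (\<Prod>h=1..N. \<beta> h - \<beta> (Suc N))"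
    using prod_pochhammer_step_n[OF q \<beta>, of "- \<beta> (Suc N)" N] by simp
  finally show ?thesis unfolding kappa_hat_def num by simp
qed

subsection \<open>Mellin transforms of the step-line forms\<close>


lemma sum_step_n:
  fixes h :: "nat \<Rightarrow> nat \<Rightarrow> real"
  assumes q: "q \<ge> 1"
  shows "(\<Sum>a=1..q. \<Sum>k<step_n q a N. h a k) = (\<Sum>i=1..N. h ((i - 1) mod q + 1) ((i - 1) div q))"
proof (induction N)
  case 0
  show ?case using q by (auto simp: step_n_0)
next
  case (Suc N)
  let ?c = "N mod q + 1"
  have c: "?c \<in> {1..q}" using q by (auto simp: Suc_leI)
  have "(\<Sum>a=1..q. \<Sum>k<step_n q a (Suc N). h a k)
    = (\<Sum>a=1..q. (\<Sum>k<step_n q a N. h a k) + (if ?c = a then h ?c (N div q) else 0))"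
  proof (intro sum.cong refl)
    fix a assume "a \<in> {1..q}"
    then show "(\<Sum>k<step_n q a (Suc N). h a k)
      = (\<Sum>k<step_n q a N. h a k) + (if ?c = a then h ?c (N div q) else 0)"
      using step_n_Suc[OF q, of a N] step_n_last[OF q, of N] by auto
  qed
  also have "\<dots> = (\<Sum>i=1..N. h ((i - 1) mod q + 1) ((i - 1) div q)) + h ?c (N div q)"
    using c unfolding sum.distrib Suc by (subst sum.delta') auto
  finally show ?case by simp
qed

lemma has_integral_powr_combination:
  fixes \<beta> d :: "'j \<Rightarrow> real"
  assumes "finite J" "\<And>j. j \<in> J \<Longrightarrow> s + \<beta> j > -1"
    and F: "\<And>x. x > 0 \<Longrightarrow> F x = (\<Sum>j\<in>J. d j * x powr \<beta> j)"
  shows "((\<lambda>x. F x * x powr s) has_integral (\<Sum>j\<in>J. d j / (s + \<beta> j + 1))) {0..1}"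
proof -
  have "((\<lambda>x. \<Sum>j\<in>J. d j * x powr (s + \<beta> j)) has_integral (\<Sum>j\<in>J. d j * (1 / (s + \<beta> j + 1)))) {0..1}"
  proof (intro has_integral_sum assms(1) has_integral_mult_right)
    fix j assume "j \<in> J"
    then show "((\<lambda>x. x powr (s + \<beta> j)) has_integral (1 / (s + \<beta> j + 1))) {0..1}"
      using has_integral_powr_from_0[of "s + \<beta> j" 1] assms(2) by simp
  qed
  moreover have "(\<Sum>j\<in>J. d j * x powr (s + \<beta> j)) = F x * x powr s" if "x \<in> {0..1}" for x
  \<comment> \<open>The endpoint is harmless although the expansion of \<open>F\<close> is known
    only for x > 0: \<open>0 powr s = 0\<close> annihilates both sides.\<close>
  proof (cases "x = 0")
    case False
    then show ?thesis using that
      by (simp add: F sum_distrib_left powr_add mult_ac)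
  qed simp
  ultimately have "((\<lambda>x. F x * x powr s) has_integral (\<Sum>j\<in>J. d j * (1 / (s + \<beta> j + 1)))) {0..1}"
    by (rule has_integral_eq[rotated])
  then show ?thesis by simp
qed

lemma sum_divide_eq_poly_divide:
  fixes b d :: "'j \<Rightarrow> real"
  assumes "finite J" "\<And>j. j \<in> J \<Longrightarrow> s + b j \<noteq> 0"
  shows "(\<Sum>j\<in>J. d j / (s + b j)) =
    poly (\<Sum>j\<in>J. smult (d j) (\<Prod>h\<in>J-{j}. [:b h, 1:])) s / (\<Prod>j\<in>J. s + b j)"
proof -
  have "d j / (s + b j) = d j * (\<Prod>h\<in>J-{j}. s + b h) / (\<Prod>j\<in>J. s + b j)" if "j \<in> J" for j
  proof -
    have "(\<Prod>j\<in>J. s + b j) = (s + b j) * (\<Prod>h\<in>J-{j}. s + b h)"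
      by (rule prod.remove[OF assms(1) that])
    moreover have "(\<Prod>h\<in>J-{j}. s + b h) \<noteq> 0" using assms by auto
    ultimately show ?thesis by simp
  qed
  then show ?thesis
    by (simp add: poly_sum poly_prod sum_divide_distrib add.commute)
qed

lemma poly_partial_fraction_numerator:
  fixes b d :: "'j \<Rightarrow> real"
  assumes "finite J" "k \<in> J"
  shows "poly (\<Sum>j\<in>J. smult (d j) (\<Prod>h\<in>J-{j}. [:b h, 1:])) (- b k) = d k * (\<Prod>h\<in>J-{k}. b h - b k)"
proof -
  have z: "(\<Prod>h\<in>J-{j}. b h - b k) = 0" if "j \<in> J - {k}" for j
    using that assms by (intro prod_zero bexI[of _ k]) auto
  have "(\<Sum>j\<in>J-{k}. d j * (\<Prod>h\<in>J-{j}. b h - b k)) = 0"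
    by (rule sum.neutral) (simp add: z)
  then show ?thesis
    unfolding poly_sum using assms by (subst sum.remove[of _ k]) (auto simp: poly_prod)
qed

lemma poly_eq_0_if_eventually_0:
  fixes f :: "real poly"
  assumes "\<And>s. s \<ge> s0 \<Longrightarrow> poly f s = 0"
  shows "f = 0"
proof (rule ccontr)
  assume "f \<noteq> 0"
  then have "finite {s. poly f s = 0}" by (rule poly_roots_finite)
  then have "finite {s0..}" by (rule rev_finite_subset) (use assms in auto)
  then show False using infinite_Ici by blast
qed

text \<open>Injectivity of the Mellin transform on finite combinations of distinct powers: the
  common numerator vanishes for all large s, hence identically, and its value at the pole
  \<open>- b k\<close> is a nonzero multiple of \<open>d k\<close>.\<close>

lemma partial_fraction_eq_0:
  fixes b d :: "'j \<Rightarrow> real"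
  assumes J: "finite J" and inj: "inj_on b J"
    and pos: "\<And>j s. j \<in> J \<Longrightarrow> s \<ge> s0 \<Longrightarrow> s + b j > 0"
    and 0: "\<And>s. s \<ge> s0 \<Longrightarrow> (\<Sum>j\<in>J. d j / (s + b j)) = 0"
    and k: "k \<in> J"
  shows "d k = 0"
proof -
  let ?Q = "\<Sum>j\<in>J. smult (d j) (\<Prod>h\<in>J-{j}. [:b h, 1:])"
  have "poly ?Q s = 0" if s: "s \<ge> s0" for s
  proof -
    have nz: "s + b j \<noteq> 0" if "j \<in> J" for j using pos[OF that s] by simp
    then have "(\<Prod>j\<in>J. s + b j) \<noteq> 0" using J by auto
    then show ?thesis
      using sum_divide_eq_poly_divide[OF J nz, where d=d] 0[OF s] by simp
  qed
  then have "?Q = 0" by (rule poly_eq_0_if_eventually_0)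
  then have "d k * (\<Prod>h\<in>J-{k}. b h - b k) = 0"
    using poly_partial_fraction_numerator[OF J k, of d b] by simp
  moreover have "(\<Prod>h\<in>J-{k}. b h - b k) \<noteq> 0"
    using J inj k by (auto dest: inj_onD)
  ultimately show ?thesis by simp
qed

lemma poly_altdef_lessThan:
  fixes f :: "real poly"
  assumes "m = 0 \<longrightarrow> f = 0" "degree f \<le> m - 1"
  shows "poly f x = (\<Sum>k<m. coeff f k * x ^ k)"
proof (cases "m = 0")
  case False
  have "poly f x = (\<Sum>k\<le>degree f. coeff f k * x ^ k)" by (rule poly_altdef)
  also have "\<dots> = (\<Sum>k<m. coeff f k * x ^ k)"
    by (rule sum.mono_neutral_left) (use assms False in \<open>auto simp: coeff_eq_0\<close>)
  finally show ?thesis .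
qed (use assms in simp)

text \<open>The conditions are stated for the extended sequences. Injectivity on all positive
  indices expresses that base parameters do not differ by integers, and the bound on sums at base
  indices implies it at all indices.\<close>

locale stepline_parameters =
  fixes p q :: nat and \<alpha> \<beta> :: "nat \<Rightarrow> real"
  assumes p: "p \<ge> 1" and q: "q \<ge> 1"
    and shift_\<alpha>: "unit_shift p \<alpha>" and shift_\<beta>: "unit_shift q \<beta>"
    and sum_gt: "i \<ge> 1 \<Longrightarrow> j \<ge> 1 \<Longrightarrow> \<alpha> i + \<beta> j > -1"
    and inj_\<alpha>: "inj_on \<alpha> {1..}" and inj_\<beta>: "inj_on \<beta> {1..}"
begin

abbreviation "\<kappa> \<equiv> kappa_hat p q \<alpha> \<beta>"

text \<open>Leading coefficient of the numerator of the transform. The sign arises because each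
  factor s - \<alpha>_i at the last pole s = -\<beta>_{N+1} - 1 is the negative of a numerator
  factor of \<open>\<kappa> N\<close>.\<close>

definition mellin_const :: "nat \<Rightarrow> real" where
  "mellin_const N = (-1) ^ N / \<kappa> N"

lemmas \<alpha>_shift = unit_shiftD[OF shift_\<alpha>] and \<beta>_shift = unit_shiftD[OF shift_\<beta>]

lemma \<alpha>_eq_iff: "i \<ge> 1 \<Longrightarrow> j \<ge> 1 \<Longrightarrow> \<alpha> i = \<alpha> j \<longleftrightarrow> i = j"
  using inj_\<alpha> by (auto dest: inj_onD)

lemma \<beta>_eq_iff: "i \<ge> 1 \<Longrightarrow> j \<ge> 1 \<Longrightarrow> \<beta> i = \<beta> j \<longleftrightarrow> i = j"
  using inj_\<beta> by (auto dest: inj_onD)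

lemma kappa_nonzero: "\<kappa> N \<noteq> 0"
proof -
  have "\<alpha> a + \<beta> (Suc N) + 1 \<noteq> 0" if "a \<ge> 1" for a using sum_gt[of a "Suc N"] that by simp
  then show ?thesis
    unfolding kappa_hat_eq[OF p q shift_\<alpha> shift_\<beta>] by (auto simp: \<beta>_eq_iff)
qed

lemma mellin_const_nonzero: "mellin_const N \<noteq> 0"
  using kappa_nonzero[of N] by (simp add: mellin_const_def)

text \<open>The term of degree k in component a is the power with exponent \<beta>_{k q + a}. The
  last index N + 1 corresponds to component \<open>step_s q N\<close> and degree
  \<open>step_d q N\<close>, hence to the monic leading term.\<close>

lemma monic_form_expansion:
  assumes "monic_stepline_form p q \<alpha> \<beta> N P"
  shows "\<exists>d. d (Suc N) = 1 \<and> (\<forall>x>0. mixed_form q \<beta> P x = (\<Sum>j=1..Suc N. d j * x powr \<beta> j))"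
proof (intro exI conjI allI impI)
  define d where "d j = coeff (P ((j - 1) mod q + 1)) ((j - 1) div q)" for j
  show "d (Suc N) = 1"
    using assms by (auto simp: d_def monic_stepline_form_def step_s_def step_d_def)
  fix x :: real assume x: "x > 0"
  have "mixed_form q \<beta> P x = (\<Sum>j=1..q. \<Sum>k<step_n q j (Suc N). coeff (P j) k * x ^ k * x powr \<beta> j)"
    unfolding mixed_form_def
  proof (intro sum.cong refl)
    fix j assume "j \<in> {1..q}"
    then have "if step_m q j N = 0 then P j = 0 else degree (P j) \<le> step_m q j N - 1"
      using assms unfolding monic_stepline_form_def by blast
    then have "poly (P j) x = (\<Sum>k<step_m q j N. coeff (P j) k * x ^ k)"
      by (intro poly_altdef_lessThan) (auto split: if_splits)
    then show "poly (P j) x * x powr \<beta> j = (\<Sum>k<step_n q j (Suc N). coeff (P j) k * x ^ k * x powr \<beta> j)"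
      by (simp add: step_m_eq_step_n sum_distrib_right)
  qed
  also have "\<dots> = (\<Sum>j=1..Suc N. d j * x powr \<beta> j)"
    unfolding sum_step_n[OF q]
  proof (intro sum.cong refl)
    fix j assume "j \<in> {1..Suc N}"
    then have "\<beta> j = \<beta> ((j - 1) mod q + 1) + real ((j - 1) div q)"
      using affine_index_mod_div[OF shift_\<beta>, of "j - 1"] by simp
    then show "coeff (P ((j - 1) mod q + 1)) ((j - 1) div q) * x ^ ((j - 1) div q)
        * x powr \<beta> ((j - 1) mod q + 1) = d j * x powr \<beta> j"
      using x by (simp add: d_def powr_add powr_realpow)
  qed
  finally show "mixed_form q \<beta> P x = (\<Sum>j=1..Suc N. d j * x powr \<beta> j)" .
qed

text \<open>The numerator \<open>Q\<close> over the common denominator has degree at most N.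
  Orthogonality gives its N zeros \<alpha>_i, and the monic normalization gives its value at the
  last pole \<open>?y\<close>. The claimed numerator \<open>T\<close> satisfies the same N + 1
  conditions at distinct points, so the two agree.\<close>

lemma mellin_monic_form:
  assumes P: "monic_stepline_form p q \<alpha> \<beta> N P" and s: "\<And>j. j \<ge> 1 \<Longrightarrow> s + \<beta> j > -1"
  shows "((\<lambda>x. mixed_form q \<beta> P x * x powr s) has_integral
    mellin_const N * (\<Prod>i=1..N. s - \<alpha> i) / (\<Prod>j=1..Suc N. s + \<beta> j + 1)) {0..1}"
proof -
  obtain d where d1: "d (Suc N) = 1"
    and d: "\<And>x. x > 0 \<Longrightarrow> mixed_form q \<beta> P x = (\<Sum>j=1..Suc N. d j * x powr \<beta> j)"
    using monic_form_expansion[OF P] by blast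
  let ?J = "{1..Suc N}"
  define b where "b j = \<beta> j + 1" for j
  define Q where "Q = (\<Sum>j\<in>?J. smult (d j) (\<Prod>h\<in>?J-{j}. [:b h, 1:]))"
  define T where "T = smult (mellin_const N) (\<Prod>i=1..N. [:- \<alpha> i, 1:])"
  have int: "((\<lambda>x. mixed_form q \<beta> P x * x powr t) has_integral poly Q t / (\<Prod>j\<in>?J. t + b j)) {0..1}"
    if t: "\<And>j. j \<ge> 1 \<Longrightarrow> t + \<beta> j > -1" for t
  proof -
    have nz: "t + b j \<noteq> 0" if "j \<in> ?J" for j using t[of j] that by (auto simp: b_def)
    have "(\<Sum>j\<in>?J. d j / (t + b j)) = poly Q t / (\<Prod>j\<in>?J. t + b j)"
      unfolding Q_def by (rule sum_divide_eq_poly_divide) (use nz in auto)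
    moreover have "((\<lambda>x. mixed_form q \<beta> P x * x powr t) has_integral (\<Sum>j\<in>?J. d j / (t + \<beta> j + 1))) {0..1}"
      by (rule has_integral_powr_combination) (use d t in auto)
    ultimately show ?thesis by (simp add: b_def add.assoc)
  qed
  have root: "poly Q (\<alpha> i) = 0" if i: "i \<in> {1..N}" for i
  proof -
    let ?a = "(i - 1) mod p + 1" and ?k = "(i - 1) div p"
    have a: "?a \<in> {1..p}" using p by (auto simp: Suc_leI)
    have "?k * p + ?a = i" using i by (metis Suc_eq_plus1 Suc_pred' add_Suc_right atLeastAtMost_iff div_mult_mod_eq less_eq_Suc_le One_nat_def)
    then have "?k < step_n p ?a N" using p i by (simp add: less_step_n_iff)
    moreover have "\<alpha> i = real ?k + \<alpha> ?a"
      using affine_index_mod_div[OF shift_\<alpha>, of "i - 1"] i by simp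
    ultimately have "((\<lambda>x. mixed_form q \<beta> P x * x powr \<alpha> i) has_integral 0) {0..1}"
      using P a unfolding monic_stepline_form_def by metis
    moreover have gt: "\<alpha> i + \<beta> j > -1" if "j \<ge> 1" for j using sum_gt i that by auto
    ultimately have "poly Q (\<alpha> i) / (\<Prod>j\<in>?J. \<alpha> i + b j) = 0"
      using int[of "\<alpha> i"] has_integral_unique by blast
    moreover have "\<alpha> i + b j \<noteq> 0" if "j \<in> ?J" for j using gt[of j] that by (auto simp: b_def)
    ultimately show ?thesis by (auto simp del: prod.cl_ivl_Suc)
  qed
  let ?y = "- b (Suc N)"
  have Jd: "?J - {Suc N} = {1..N}" by auto
  have "poly Q ?y = d (Suc N) * (\<Prod>h\<in>?J - {Suc N}. b h - b (Suc N))"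
    unfolding Q_def by (rule poly_partial_fraction_numerator) auto
  also have "\<dots> = (\<Prod>h=1..N. \<beta> h - \<beta> (Suc N))"
    unfolding Jd by (simp add: d1 b_def)
  also have "\<dots> = poly T ?y"
  proof -
    have e: "poly (\<Prod>i=1..N. [:- \<alpha> i, 1:]) ?y = (-1) ^ N * (\<Prod>i=1..N. \<alpha> i + \<beta> (Suc N) + 1)"
    proof -
      have "poly (\<Prod>i=1..N. [:- \<alpha> i, 1:]) ?y = (\<Prod>i=1..N. (-1) * (\<alpha> i + \<beta> (Suc N) + 1))"
        unfolding poly_prod by (intro prod.cong) (auto simp: b_def)
      then show ?thesis unfolding prod.distrib by simp
    qed
    have "\<alpha> a + \<beta> (Suc N) + 1 \<noteq> 0" if "a \<in> {1..N}" for a using sum_gt[of a "Suc N"] that by simp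
    then have "(\<Prod>i=1..N. \<alpha> i + \<beta> (Suc N) + 1) \<noteq> 0" by auto
    then show ?thesis
      unfolding T_def poly_smult e
      by (simp add: mellin_const_def kappa_hat_eq[OF p q shift_\<alpha> shift_\<beta>])
  qed
  finally have rooty: "poly (Q - T) ?y = 0" by simp
  have "degree Q \<le> N"
    unfolding Q_def
  proof (rule degree_sum_le)
    fix j assume "j \<in> ?J"
    then have "degree (\<Prod>h\<in>?J-{j}. [:b h, 1:]) = N"
      using degree_prod_linear[of "\<lambda>h. - b h" "?J - {j}"] by simp
    then show "degree (smult (d j) (\<Prod>h\<in>?J-{j}. [:b h, 1:])) \<le> N"
      by (metis degree_smult_le)
  qed simp
  moreover have "degree T \<le> N"
    unfolding T_def using degree_prod_linear[of \<alpha> "{1..N}"] by (metis card_atLeastAtMost degree_smult_le diff_Suc_1)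
  ultimately have deg: "degree (Q - T) \<le> N" by (rule degree_diff_le)
  have "Q - T = 0"
  proof (rule ccontr)
    assume nz: "Q - T \<noteq> 0"
    have "\<alpha> ` {1..N} \<union> {?y} \<subseteq> {z. poly (Q - T) z = 0}"
    proof -
      have "poly (Q - T) (\<alpha> i) = 0" if "i \<in> {1..N}" for i
      proof -
        have "(\<Prod>k=1..N. \<alpha> i - \<alpha> k) = 0" using that by (intro prod_zero bexI[of _ i]) auto
        then show ?thesis using root[OF that] by (simp add: T_def poly_prod)
      qed
      then show ?thesis using rooty by blast
    qed
    then have "card (\<alpha> ` {1..N} \<union> {?y}) \<le> card {z. poly (Q - T) z = 0}"
      by (rule card_mono[OF poly_roots_finite[OF nz]])
    also have "\<dots> \<le> N" using card_poly_roots_bound[OF nz] deg by linarith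
    finally have "card (\<alpha> ` {1..N} \<union> {?y}) \<le> N" .
    moreover have "?y \<notin> \<alpha> ` {1..N}"
    proof
      assume "?y \<in> \<alpha> ` {1..N}"
      then obtain i where "i \<ge> 1" "?y = \<alpha> i" by auto
      then show False using sum_gt[of i "Suc N"] by (simp add: b_def)
    qed
    moreover have "card (\<alpha> ` {1..N}) = N"
      using card_image[of \<alpha> "{1..N}"] inj_on_subset[OF inj_\<alpha>, of "{1..N}"] by auto
    ultimately show False by simp
  qed
  then have "poly Q s = mellin_const N * (\<Prod>i=1..N. s - \<alpha> i)"
    by (simp add: T_def poly_prod)
  then show ?thesis using int[OF s] by (simp add: b_def add.assoc del: prod.cl_ivl_Suc)
qed

end

subsection \<open>The recurrence as a polynomial identity\<close>


lemma prod_atLeastAtMost_split: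
  fixes g :: "nat \<Rightarrow> 'a::comm_monoid_mult"
  assumes "a \<le> Suc b" "b \<le> c"
  shows "prod g {a..c} = prod g {a..b} * prod g {Suc b..c}"
  using prod.ub_add_nat[of a b g "c - b"] assms by simp

text \<open>Indices below zero contribute nothing, so the three sums join into one over natural
  numbers. The lower end \<open>n - min p n\<close> absorbs the case n < p.\<close>

lemma sum_int_window:
  fixes h :: "int \<Rightarrow> real"
  assumes "\<And>k. k < 0 \<Longrightarrow> h k = 0"
  shows "(\<Sum>j=1..q. h (int n + int j)) + h (int n) + (\<Sum>i=1..p. h (int n - int i))
    = (\<Sum>N=n - min p n..n + q. h (int N))"
proof -
  have 1: "(\<Sum>j=1..q. h (int n + int j)) = (\<Sum>N=n+1..n+q. h (int N))"
    using sum.shift_bounds_cl_nat_ivl[of "\<lambda>N. h (int N)" 1 n q] by (simp add: add.commute)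
  have "(\<Sum>i=1..p. h (int n - int i)) = (\<Sum>i=1..min p n. h (int n - int i))"
    by (rule sum.mono_neutral_right) (use assms in auto)
  also have "\<dots> = (\<Sum>N=n - min p n..<n. h (int N))"
    by (rule sum.reindex_bij_witness[of _ "\<lambda>N. n - N" "\<lambda>i. n - i"]) (auto simp: of_nat_diff)
  finally have 2: "(\<Sum>i=1..p. h (int n - int i)) = (\<Sum>N=n - min p n..<n. h (int N))" .
  have "sum g {n - min p n..n + q} = sum g {n - min p n..<n} + g n + sum g {n+1..n+q}"
    for g :: "nat \<Rightarrow> real"
    using sum.ub_add_nat[of "n - min p n" n g q] sum.last_plus[of "n - min p n" n g] by (simp add: add_ac)
  then have "(\<Sum>N=n - min p n..n + q. h (int N))
     = (\<Sum>N=n - min p n..<n. h (int N)) + h (int n) + (\<Sum>N=n+1..n+q. h (int N))"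
    .
  then show ?thesis using 1 2 by simp
qed

context stepline_parameters
begin

definition node :: "nat \<Rightarrow> real" where "node j = - \<beta> j - 1"

lemma diff_node: "s - node j = s + \<beta> j + 1"
  by (simp add: node_def)

lemma node_neq_\<alpha>: "i \<ge> 1 \<Longrightarrow> j \<ge> 1 \<Longrightarrow> \<alpha> i \<noteq> node j"
  using sum_gt[of i j] by (simp add: node_def)

lemma node_eq_iff: "i \<ge> 1 \<Longrightarrow> j \<ge> 1 \<Longrightarrow> node i = node j \<longleftrightarrow> i = j"
  by (simp add: node_def \<beta>_eq_iff)

text \<open>What remains of the transform at s + 1 after cancellation. For i > p the factor s + 1 -
  \<alpha>_i equals s - \<alpha>_{i-p} and is a zero common to the whole window, so only the first
  min p n numerator factors stay. The denominator factors are s + \<beta>_{j+q} + 1, so clearing the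
  common denominator leaves the first q of them.\<close>

definition shifted_numerator :: "nat \<Rightarrow> real poly" where
  "shifted_numerator n = smult (mellin_const n)
     ((\<Prod>i=1..min p n. [:1 - \<alpha> i, 1:]) * (\<Prod>j=1..q. [:\<beta> j + 1, 1:]))"

lemma poly_shifted_numerator:
  "poly (shifted_numerator n) s =
     mellin_const n * (\<Prod>i=1..min p n. s + 1 - \<alpha> i) * (\<Prod>j=1..q. s + \<beta> j + 1)"
  by (simp add: shifted_numerator_def poly_prod algebra_simps)

lemma prod_\<alpha>_split:
  "(\<Prod>i=1..n. \<phi> (\<alpha> i)) = (\<Prod>i=1..min p n. \<phi> (\<alpha> i)) * (\<Prod>i=1..n - min p n. \<phi> (\<alpha> i + 1))"
  for \<phi> :: "real \<Rightarrow> real"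
proof -
  have "(\<Prod>i=1..n. \<phi> (\<alpha> i)) = (\<Prod>i=1..min p n. \<phi> (\<alpha> i)) * (\<Prod>i=Suc (min p n)..n. \<phi> (\<alpha> i))"
    by (rule prod_atLeastAtMost_split) auto
  also have "(\<Prod>i=Suc (min p n)..n. \<phi> (\<alpha> i)) = (\<Prod>i=1..n - min p n. \<phi> (\<alpha> i + 1))"
  proof (cases "p \<le> n")
    case True
    have "(\<Prod>i=Suc p..n. \<phi> (\<alpha> i)) = (\<Prod>i=1..n-p. \<phi> (\<alpha> (i + p)))"
      using True prod.shift_bounds_cl_nat_ivl[of "\<lambda>i. \<phi> (\<alpha> i)" 1 p "n - p"] by simp
    also have "\<dots> = (\<Prod>i=1..n-p. \<phi> (\<alpha> i + 1))"
      by (intro prod.cong) (auto simp: \<alpha>_shift)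
    finally show ?thesis using True by (simp add: min_def)
  qed (simp add: min_def)
  finally show ?thesis .
qed

definition mellin :: "nat \<Rightarrow> real \<Rightarrow> real" where
  "mellin N s = mellin_const N * (\<Prod>i=1..N. s - \<alpha> i) / (\<Prod>j=1..Suc N. s + \<beta> j + 1)"

lemma mellin_shift_times:
  assumes s: "\<And>j. j \<ge> 1 \<Longrightarrow> s + \<beta> j > -1"
  shows "mellin n (s + 1) * (\<Prod>j=1..Suc (n + q). s + \<beta> j + 1)
    = poly (shifted_numerator n) s * (\<Prod>i=1..n - min p n. s - \<alpha> i)"
proof -
  have a: "(\<Prod>i=1..n. s + 1 - \<alpha> i) = (\<Prod>i=1..min p n. s + 1 - \<alpha> i) * (\<Prod>i=1..n - min p n. s - \<alpha> i)"
    using prod_\<alpha>_split[of "\<lambda>z. s + 1 - z" n] by (simp add: algebra_simps)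
  have "(\<Prod>j=1..Suc (n + q). s + \<beta> j + 1) = (\<Prod>j=1..q. s + \<beta> j + 1) * (\<Prod>j=Suc q..Suc (n + q). s + \<beta> j + 1)"
    by (rule prod_atLeastAtMost_split) auto
  also have "(\<Prod>j=Suc q..Suc (n + q). s + \<beta> j + 1) = (\<Prod>j=1..Suc n. s + \<beta> (j + q) + 1)"
    using prod.shift_bounds_cl_nat_ivl[of "\<lambda>j. s + \<beta> j + 1" 1 q "Suc n"] by (simp del: prod.cl_ivl_Suc)
  also have "\<dots> = (\<Prod>j=1..Suc n. s + 1 + \<beta> j + 1)"
    by (intro prod.cong) (auto simp: \<beta>_shift)
  finally have b: "(\<Prod>j=1..Suc (n + q). s + \<beta> j + 1) = (\<Prod>j=1..q. s + \<beta> j + 1) * (\<Prod>j=1..Suc n. s + 1 + \<beta> j + 1)" .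
  have "s + 1 + \<beta> j + 1 \<noteq> 0" if "j \<in> {1..Suc n}" for j using s[of j] that by auto
  then have "(\<Prod>j=1..Suc n. s + 1 + \<beta> j + 1) \<noteq> 0" by (auto simp del: prod.cl_ivl_Suc)
  then show ?thesis
    unfolding mellin_def a b poly_shifted_numerator by (simp add: field_simps del: prod.cl_ivl_Suc)
qed

lemma mellin_times:
  assumes s: "\<And>j. j \<ge> 1 \<Longrightarrow> s + \<beta> j > -1" and "M \<le> N" "N \<le> L"
  shows "mellin N s * (\<Prod>j=1..Suc L. s + \<beta> j + 1)
    = mellin_const N * ((\<Prod>i=M+1..N. s - \<alpha> i) * (\<Prod>j=N+2..L+1. s - node j)) * (\<Prod>i=1..M. s - \<alpha> i)"
proof -
  have a: "(\<Prod>i=1..N. s - \<alpha> i) = (\<Prod>i=1..M. s - \<alpha> i) * (\<Prod>i=Suc M..N. s - \<alpha> i)"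
    by (rule prod_atLeastAtMost_split) (use assms in auto)
  have b: "(\<Prod>j=1..Suc L. s + \<beta> j + 1) = (\<Prod>j=1..Suc N. s + \<beta> j + 1) * (\<Prod>j=Suc (Suc N)..Suc L. s + \<beta> j + 1)"
    by (rule prod_atLeastAtMost_split) (use assms in auto)
  have "s + \<beta> j + 1 \<noteq> 0" if "j \<in> {1..Suc N}" for j using s[of j] that by auto
  then have "(\<Prod>j=1..Suc N. s + \<beta> j + 1) \<noteq> 0" by (auto simp del: prod.cl_ivl_Suc)
  then show ?thesis
    unfolding mellin_def a b diff_node by (simp add: field_simps del: prod.cl_ivl_Suc)
qed

text \<open>The common zeros stay on both sides as a factor, since s may be one of the \<alpha>_i
  with i <= M. The equivalence thus holds at every s in the domain of convergence, and cancellation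
  is left to the place where s is known to avoid them.\<close>

lemma mellin_combination_iff:
  fixes n :: nat
  assumes s: "\<And>j. j \<ge> 1 \<Longrightarrow> s + \<beta> j > -1"
  defines "M \<equiv> n - min p n"
  shows "mellin n (s + 1) = (\<Sum>N=M..n+q. e N * mellin N s) \<longleftrightarrow>
    poly (shifted_numerator n) s * (\<Prod>i=1..M. s - \<alpha> i) =
    (\<Sum>N=M..n+q. e N * mellin_const N * ((\<Prod>i=M+1..N. s - \<alpha> i) * (\<Prod>j=N+2..n+q+1. s - node j)))
      * (\<Prod>i=1..M. s - \<alpha> i)"
    (is "?l = ?r \<longleftrightarrow> ?l' = ?r'")
proof -
  let ?D = "\<Prod>j=1..Suc (n + q). s + \<beta> j + 1"
  have "s + \<beta> j + 1 \<noteq> 0" if "j \<in> {1..Suc (n + q)}" for j using s[of j] that by auto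
  then have D: "?D \<noteq> 0" by (auto simp del: prod.cl_ivl_Suc)
  have r: "?r * ?D = ?r'"
    unfolding sum_distrib_right
  proof (intro sum.cong refl)
    fix N assume N: "N \<in> {M..n+q}"
    have "mellin N s * ?D = mellin_const N * ((\<Prod>i=M+1..N. s - \<alpha> i) * (\<Prod>j=N+2..n+q+1. s - node j)) * (\<Prod>i=1..M. s - \<alpha> i)"
      by (rule mellin_times[OF s]) (use N in auto)
    then show "e N * mellin N s * ?D = e N * mellin_const N * ((\<Prod>i=M+1..N. s - \<alpha> i) * (\<Prod>j=N+2..n+q+1. s - node j))
      * (\<Prod>i=1..M. s - \<alpha> i)" by (simp only: mult.assoc)
  qed
  have l: "?l * ?D = ?l'" unfolding M_def by (rule mellin_shift_times[OF s])
  have "?l = ?r \<longleftrightarrow> ?l * ?D = ?r * ?D"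
    unfolding mult_cancel_right using D by blast
  then show ?thesis unfolding l r .
qed

context
  fixes B :: "int \<Rightarrow> nat \<Rightarrow> real poly"
  assumes monic: "\<And>N::nat. monic_stepline_form p q \<alpha> \<beta> N (B (int N))"
    and neg: "\<And>N j. N < 0 \<Longrightarrow> B N j = 0"
begin

lemma has_integral_form:
  assumes "\<And>j. j \<ge> 1 \<Longrightarrow> s + \<beta> j > -1"
  shows "((\<lambda>x. mixed_form q \<beta> (B (int N)) x * x powr s) has_integral mellin N s) {0..1}"
  unfolding mellin_def using mellin_monic_form[OF monic assms] .

lemma has_integral_x_form:
  assumes "\<And>j. j \<ge> 1 \<Longrightarrow> s + \<beta> j > -1"
  shows "((\<lambda>x. x * mixed_form q \<beta> (B (int n)) x * x powr s) has_integral mellin n (s + 1)) {0..1}"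
proof -
  have "s + 1 + \<beta> j > -1" if "j \<ge> 1" for j using assms[OF that] by simp
  then have "((\<lambda>x. mixed_form q \<beta> (B (int n)) x * x powr (s + 1)) has_integral mellin n (s + 1)) {0..1}"
    by (rule has_integral_form)
  moreover have "mixed_form q \<beta> (B (int n)) x * x powr (s + 1) = x * mixed_form q \<beta> (B (int n)) x * x powr s"
    if "x \<in> {0..1}" for x
    using that by (cases "x = 0") (auto simp: powr_add)
  ultimately show ?thesis by (rule has_integral_eq[rotated])
qed

text \<open>Left to right, the transforms agree for all large s, which forces equality of
  polynomials. Right to left, both sides are finite combinations of the powers x^{\<beta>_j} with
  equal transforms, so all coefficients of their difference vanish.\<close>

lemma form_identity_iff:
  fixes n :: nat
  defines "M \<equiv> n - min p n"
  shows "(\<forall>x>0. x * mixed_form q \<beta> (B (int n)) x = (\<Sum>N=M..n+q. e N * mixed_form q \<beta> (B (int N)) x)) \<longleftrightarrow>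
    (\<forall>s. poly (shifted_numerator n) s =
      (\<Sum>N=M..n+q. e N * mellin_const N * ((\<Prod>i=M+1..N. s - \<alpha> i) * (\<Prod>j=N+2..n+q+1. s - node j))))"
    (is "?F \<longleftrightarrow> ?I")
proof
  assume F: ?F
  \<comment> \<open>Beyond \<open>s0\<close> none of the common zeros \<alpha>_1, ..., \<alpha>_M is
    met. Taking the maximum up to Suc M keeps the set nonempty and always includes \<alpha>_1, which
    gives s + \<beta>_j > -1 and hence convergence.\<close>
  define s0 where "s0 = Max (\<alpha> ` {1..Suc M}) + 1"
  define W where "W = shifted_numerator n - (\<Sum>N=M..n+q. smult (e N * mellin_const N)
     ((\<Prod>i=M+1..N. [:- \<alpha> i, 1:]) * (\<Prod>j=N+2..n+q+1. [:- node j, 1:])))"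
  have "poly W s = 0" if s: "s \<ge> s0" for s
  proof -
    have gt: "\<alpha> i < s" if "i \<in> {1..Suc M}" for i
    proof -
      have "\<alpha> i \<le> Max (\<alpha> ` {1..Suc M})" using that by (intro Max_ge) auto
      then show ?thesis using s by (simp add: s0_def)
    qed
    have ok: "s + \<beta> j > -1" if "j \<ge> 1" for j using gt[of 1] sum_gt[of 1 j] that by simp
    have "((\<lambda>x. \<Sum>N=M..n+q. e N * (mixed_form q \<beta> (B (int N)) x * x powr s)) has_integral
       (\<Sum>N=M..n+q. e N * mellin N s)) {0..1}"
      by (intro has_integral_sum has_integral_mult_right has_integral_form ok) auto
    moreover have "(\<Sum>N=M..n+q. e N * (mixed_form q \<beta> (B (int N)) x * x powr s))
       = x * mixed_form q \<beta> (B (int n)) x * x powr s" if "x \<in> {0..1}" for x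
    proof (cases "x = 0")
      case False
      then show ?thesis using F that by (simp add: sum_distrib_right mult.assoc)
    qed simp
    ultimately have "((\<lambda>x. x * mixed_form q \<beta> (B (int n)) x * x powr s) has_integral
       (\<Sum>N=M..n+q. e N * mellin N s)) {0..1}"
      by (rule has_integral_eq[rotated])
    then have "mellin n (s + 1) = (\<Sum>N=M..n+q. e N * mellin N s)"
      using has_integral_x_form[OF ok] has_integral_unique by blast
    then have "poly (shifted_numerator n) s * (\<Prod>i=1..M. s - \<alpha> i) =
      (\<Sum>N=M..n+q. e N * mellin_const N * ((\<Prod>i=M+1..N. s - \<alpha> i) * (\<Prod>j=N+2..n+q+1. s - node j)))
        * (\<Prod>i=1..M. s - \<alpha> i)"
      using mellin_combination_iff[OF ok, of n e] unfolding M_def by blast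
    moreover have "(\<Prod>i=1..M. s - \<alpha> i) \<noteq> 0" using gt by fastforce
    ultimately have "poly (shifted_numerator n) s =
      (\<Sum>N=M..n+q. e N * mellin_const N * ((\<Prod>i=M+1..N. s - \<alpha> i) * (\<Prod>j=N+2..n+q+1. s - node j)))"
      unfolding mult_cancel_right by blast
    then show ?thesis by (simp add: W_def poly_sum poly_prod del: prod.cl_ivl_Suc sum.cl_ivl_Suc)
  qed
  then have "W = 0" by (rule poly_eq_0_if_eventually_0)
  show ?I
  proof
    fix s
    have "poly W s = 0" using \<open>W = 0\<close> by simp
    then show "poly (shifted_numerator n) s =
      (\<Sum>N=M..n+q. e N * mellin_const N * ((\<Prod>i=M+1..N. s - \<alpha> i) * (\<Prod>j=N+2..n+q+1. s - node j)))"
      by (simp add: W_def poly_sum poly_prod del: prod.cl_ivl_Suc sum.cl_ivl_Suc)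
  qed
next
  assume I: ?I
  let ?J = "{1..Suc (n + q)}"
  have "\<forall>N. \<exists>d. \<forall>x>0. mixed_form q \<beta> (B (int N)) x = (\<Sum>j=1..Suc N. d j * x powr \<beta> j)"
    using monic_form_expansion[OF monic] by blast
  then obtain d where d: "\<And>N x. x > 0 \<Longrightarrow> mixed_form q \<beta> (B (int N)) x = (\<Sum>j=1..Suc N. d N j * x powr \<beta> j)"
    by metis
  \<comment> \<open>Coefficient of x^{\<beta>_j} in the difference \<open>D\<close>: multiplication
    by x moves index j to j + q, and the shorter forms are padded with zeros up to n + q +
    1.\<close>
  define c where "c j = (if j > q then d n (j - q) else 0) -
    (\<Sum>N=M..n+q. e N * (if j \<le> Suc N then d N j else 0))" for j
  define D where "D x = x * mixed_form q \<beta> (B (int n)) x - (\<Sum>N=M..n+q. e N * mixed_form q \<beta> (B (int N)) x)" for x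
  have D: "D x = (\<Sum>j\<in>?J. c j * x powr \<beta> j)" if x: "x > 0" for x
  proof -
    have "x * mixed_form q \<beta> (B (int n)) x = (\<Sum>j=1..Suc n. d n j * x powr \<beta> (j + q))"
      using x by (simp add: d sum_distrib_left \<beta>_shift powr_add mult_ac del: sum.cl_ivl_Suc)
    also have "\<dots> = (\<Sum>j=Suc q..Suc (n + q). d n (j - q) * x powr \<beta> j)"
      using sum.shift_bounds_cl_nat_ivl[of "\<lambda>j. d n (j - q) * x powr \<beta> j" 1 q "Suc n"] by (simp del: sum.cl_ivl_Suc)
    also have "\<dots> = (\<Sum>j\<in>?J. (if j > q then d n (j - q) else 0) * x powr \<beta> j)"
      by (rule sum.mono_neutral_cong_left) auto
    finally have 1: "x * mixed_form q \<beta> (B (int n)) x = (\<Sum>j\<in>?J. (if j > q then d n (j - q) else 0) * x powr \<beta> j)" .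
    have "(\<Sum>N=M..n+q. e N * mixed_form q \<beta> (B (int N)) x)
      = (\<Sum>N=M..n+q. \<Sum>j\<in>?J. e N * (if j \<le> Suc N then d N j else 0) * x powr \<beta> j)"
    proof (intro sum.cong refl)
      fix N assume N: "N \<in> {M..n+q}"
      have "mixed_form q \<beta> (B (int N)) x = (\<Sum>j\<in>?J. (if j \<le> Suc N then d N j else 0) * x powr \<beta> j)"
        unfolding d[OF x] by (rule sum.mono_neutral_cong_left) (use N in auto)
      then show "e N * mixed_form q \<beta> (B (int N)) x = (\<Sum>j\<in>?J. e N * (if j \<le> Suc N then d N j else 0) * x powr \<beta> j)"
        by (simp add: sum_distrib_left mult.assoc del: sum.cl_ivl_Suc)
    qed
    also have "\<dots> = (\<Sum>j\<in>?J. \<Sum>N=M..n+q. e N * (if j \<le> Suc N then d N j else 0) * x powr \<beta> j)"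
      by (rule sum.swap)
    finally show ?thesis unfolding D_def 1 c_def
      by (simp only: sum_subtractf[symmetric] left_diff_distrib sum_distrib_right)
  qed
  have c0: "c j = 0" if j: "j \<in> ?J" for j
  proof (rule partial_fraction_eq_0[where J="?J" and b="\<lambda>j. \<beta> j + 1" and ?s0.0="\<alpha> 1"])
    show "inj_on (\<lambda>j. \<beta> j + 1) ?J" by (auto simp: inj_on_def \<beta>_eq_iff)
    have ok: "s + \<beta> j > -1" if "s \<ge> \<alpha> 1" "j \<ge> 1" for s j using that sum_gt[of 1 j] by simp
    show "s + (\<beta> j + 1) > 0" if "j \<in> ?J" "s \<ge> \<alpha> 1" for s j using ok[of s j] that by simp
    fix s assume s: "s \<ge> \<alpha> 1"
    have "((\<lambda>x. D x * x powr s) has_integral (\<Sum>j\<in>?J. c j / (s + \<beta> j + 1))) {0..1}"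
      by (rule has_integral_powr_combination) (use D ok[OF s] in auto)
    moreover have "((\<lambda>x. D x * x powr s) has_integral 0) {0..1}"
    proof -
      have "((\<lambda>x. x * mixed_form q \<beta> (B (int n)) x * x powr s - (\<Sum>N=M..n+q. e N * (mixed_form q \<beta> (B (int N)) x * x powr s)))
        has_integral mellin n (s + 1) - (\<Sum>N=M..n+q. e N * mellin N s)) {0..1}"
        by (intro has_integral_diff has_integral_x_form has_integral_sum has_integral_mult_right has_integral_form ok[OF s]) auto
      moreover have "mellin n (s + 1) = (\<Sum>N=M..n+q. e N * mellin N s)"
        using mellin_combination_iff[OF ok[OF s], of n e] I unfolding M_def by simp
      ultimately show ?thesis
        by (simp add: D_def left_diff_distrib sum_distrib_right mult.assoc)
    qed
    ultimately have "(\<Sum>j\<in>?J. c j / (s + \<beta> j + 1)) = 0" by (rule has_integral_unique)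
    then show "(\<Sum>j\<in>?J. c j / (s + (\<beta> j + 1))) = 0" by (simp only: add.assoc)
  qed (use j in auto)
  show ?F
  proof (intro allI impI)
    fix x :: real assume x: "x > 0"
    have "D x = 0" unfolding D[OF x] by (rule sum.neutral) (use c0 in simp)
    then show "x * mixed_form q \<beta> (B (int n)) x = (\<Sum>N=M..n+q. e N * mixed_form q \<beta> (B (int N)) x)"
      by (simp add: D_def)
  qed
qed

lemma recurrence_coeffs_iff:
  fixes n :: nat
  defines "M \<equiv> n - min p n"
  shows "recurrence_coeffs p q \<beta> B n b \<longleftrightarrow>
    (\<forall>s. poly (shifted_numerator n) s = (\<Sum>N=M..n+q. b (int N - int n) * mellin_const N
       * ((\<Prod>i=M+1..N. s - \<alpha> i) * (\<Prod>j=N+2..n+q+1. s - node j)))) \<and>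
    (\<forall>i\<in>{1..p}. i > n \<longrightarrow> b (- int i) = 0)"
proof -
  have "mixed_form q \<beta> (B k) x = 0" if "k < 0" for k x
    using that by (simp add: mixed_form_def neg)
  then have "(\<Sum>j=1..q. b (int j) * mixed_form q \<beta> (B (int n + int j)) x) + b 0 * mixed_form q \<beta> (B (int n)) x
      + (\<Sum>i=1..p. b (- int i) * mixed_form q \<beta> (B (int n - int i)) x)
    = (\<Sum>N=M..n+q. b (int N - int n) * mixed_form q \<beta> (B (int N)) x)" for x
    using sum_int_window[of "\<lambda>k. b (k - int n) * mixed_form q \<beta> (B k) x" n q p] by (simp add: M_def)
  then show ?thesis
    unfolding recurrence_coeffs_def M_def
    using form_identity_iff[of n "\<lambda>N. b (int N - int n)"] by simp
qed

text \<open>The degree min p n + q of the shifted numerator is exactly the length of the window, so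
  the mixed Newton expansion applies. Dividing its coefficients by the nonzero Mellin constants
  gives the recurrence coefficients, with zero for negative indices.\<close>

lemma ex_recurrence_coeffs: "\<exists>b. recurrence_coeffs p q \<beta> B n b"
proof -
  define M where "M = n - min p n"
  have "degree (shifted_numerator n) \<le> min p n + q"
  proof -
    have "degree ((\<Prod>i=1..min p n. [:1 - \<alpha> i, 1:]) * (\<Prod>j=1..q. [:\<beta> j + 1, 1:])) \<le> min p n + q"
      using degree_prod_linear[of "\<lambda>i. \<alpha> i - 1" "{1..min p n}"] degree_prod_linear[of node "{1..q}"]
      by (intro order.trans[OF degree_mult_le]) (simp add: node_def add.commute)
    then show ?thesis unfolding shifted_numerator_def using degree_smult_le order.trans by blast
  qed
  then have "degree (shifted_numerator n) \<le> n + q - M" by (simp add: M_def)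
  then have "\<exists>e. \<forall>s. poly (shifted_numerator n) s =
     (\<Sum>N=M..n+q. e N * ((\<Prod>i=M+1..N. s - \<alpha> i) * (\<Prod>j=N+2..n+q+1. s - node j)))"
    by (rule mixed_newton_expansion) (auto simp: M_def node_neq_\<alpha>)
  then obtain e where e: "\<And>s. poly (shifted_numerator n) s =
     (\<Sum>N=M..n+q. e N * ((\<Prod>i=M+1..N. s - \<alpha> i) * (\<Prod>j=N+2..n+q+1. s - node j)))"
    by blast
  define b where "b k = (if int n + k < 0 then 0 else e (nat (int n + k)) / mellin_const (nat (int n + k)))" for k
  have "recurrence_coeffs p q \<beta> B n b"
    unfolding recurrence_coeffs_iff M_def[symmetric]
    using e mellin_const_nonzero by (simp add: b_def del: prod.cl_ivl_Suc sum.cl_ivl_Suc)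
  then show ?thesis by blast
qed

end

end

subsection \<open>Coefficients as divided differences\<close>


lemma prod_diff_swap:
  fixes f g :: "'i \<Rightarrow> real"
  shows "(\<Prod>i\<in>I. f i - g i) = (-1) ^ card I * (\<Prod>i\<in>I. g i - f i)"
  using prod_uminus[of "\<lambda>i. g i - f i" I] by simp

context stepline_parameters
begin

lemma sum_pos_if_gt: "i > p \<Longrightarrow> j \<ge> 1 \<Longrightarrow> \<alpha> i + \<beta> j > 0"
  using sum_gt[of "i - p" j] \<alpha>_shift[of "i - p"] by (simp add: Suc_le_eq)

lemma mellin_const_ratio: "mellin_const n / mellin_const N = (-1) ^ (n + N) * (\<kappa> N / \<kappa> n)"
proof -
  have "((-1::real) ^ N) * (-1) ^ N = 1" by (simp add: power_mult_distrib[symmetric])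
  then have "1 / ((-1::real) ^ N) = (-1) ^ N" by (simp add: field_simps)
  then show ?thesis unfolding mellin_const_def power_add
    by (metis (no_types, opaque_lifting) divide_divide_eq_left divide_divide_eq_right mult.commute
        mult.right_neutral times_divide_eq_right)
qed

text \<open>A summand of the divided difference at the node \<alpha>_u - 1, up to
  \<open>mellin_const n\<close>. All p factors \<alpha>_u - \<alpha>_a are kept, rather than min p n
  of them, so that one expression serves n < p and n >= p.\<close>

definition \<alpha>_residue :: "nat \<Rightarrow> nat \<Rightarrow> nat \<Rightarrow> real" where
  "\<alpha>_residue n N u = (\<Prod>a=1..p. \<alpha> u - \<alpha> a) * (\<Prod>j=1..q. \<alpha> u + \<beta> j) /
     ((\<Prod>v\<in>{n+1..N+p+1}-{u}. \<alpha> u - \<alpha> v) * (\<Prod>j=N+1..n+q+1. \<alpha> u + \<beta> j))"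

text \<open>A summand of the divided difference at the node -\<beta>_h - 1, up to sign and
  \<open>mellin_const n\<close>. It is expanded by the product of \<alpha>_i + \<beta>_h + 1 over i
  <= M, which makes both \<alpha> products start at 1 and removes M from the expression.\<close>

definition \<beta>_residue :: "nat \<Rightarrow> nat \<Rightarrow> nat \<Rightarrow> real" where
  "\<beta>_residue n N h = (\<Prod>i=1..n. \<alpha> i + \<beta> h) * (\<Prod>j=1..q. \<beta> j - \<beta> h) /
     ((\<Prod>k\<in>{N+1..n+q+1}-{h}. \<beta> k - \<beta> h) * (\<Prod>i=1..N+1. \<alpha> i + \<beta> h + 1))"

context
  fixes n :: nat and e :: "nat \<Rightarrow> real" and M :: nat
  assumes M: "M = n - min p n"
    and e: "\<And>s. poly (shifted_numerator n) s = (\<Sum>N=M..n+q. e N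
       * ((\<Prod>i=M+1..N. s - \<alpha> i) * (\<Prod>j=N+2..n+q+1. s - node j)))"
begin

text \<open>
  The nodes \<open>\<alpha> i\<close>, \<open>M < i \<le> N + 1\<close>, are written as \<open>\<alpha> u - 1\<close> with \<open>u = i + p\<close>. If \<open>n < p\<close>, the sum over \<open>u\<close> has
  extra terms \<open>n < u \<le> p\<close>; they contain the factor \<open>\<alpha> u - \<alpha> u\<close> and vanish, also where
  \<open>\<alpha> u + \<beta> j = 0\<close> makes the denominator zero.
\<close>

lemma coefficient_\<alpha>_residues:
  assumes N: "M \<le> N" "N \<le> n + q"
  shows "e N = (\<alpha> (N + 1) + \<beta> (N + 1) + 1) * mellin_const n * (\<Sum>u=n+1..N+p+1. \<alpha>_residue n N u)"
proof -
  let ?t = "\<lambda>i. poly (shifted_numerator n) (\<alpha> i) /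
     ((\<Prod>k\<in>{M+1..N+1}-{i}. \<alpha> i - \<alpha> k) * (\<Prod>j=N+1..n+q+1. \<alpha> i - node j))"
  have "e N = (\<alpha> (N + 1) - node (N + 1)) * (\<Sum>i=M+1..N+1. ?t i)"
    by (rule mixed_newton_coefficient_left[OF e N])
      (use node_neq_\<alpha> inj_on_subset[OF inj_\<alpha>] in auto)
  also have "(\<Sum>i=M+1..N+1. ?t i) = (\<Sum>i=M+1..N+1. mellin_const n * \<alpha>_residue n N (i + p))"
  proof (intro sum.cong refl)
    fix i assume i: "i \<in> {M+1..N+1}"
    let ?u = "i + p"
    have u: "\<alpha> ?u = \<alpha> i + 1" using i by (simp add: \<alpha>_shift)
    have Mp: "n \<le> M + p" using M by auto
    \<comment> \<open>The block n+1..M+p is empty for n >= p and equals n+1..p for n < p. It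
      supplies the factors absent from \<open>shifted_numerator\<close>, and the same block in the
      denominator cancels it. It is nonzero because \<open>?u\<close> exceeds M + p.\<close>
    have 1: "(\<Prod>a=1..p. \<alpha> ?u - \<alpha> a) = (\<Prod>a=1..min p n. \<alpha> ?u - \<alpha> a) * (\<Prod>a=n+1..M+p. \<alpha> ?u - \<alpha> a)"
    proof -
      have "(\<Prod>a=1..p. \<alpha> ?u - \<alpha> a) = (\<Prod>a=1..min p n. \<alpha> ?u - \<alpha> a) * (\<Prod>a=Suc (min p n)..p. \<alpha> ?u - \<alpha> a)"
        by (rule prod_atLeastAtMost_split) auto
      moreover have "{Suc (min p n)..p} = {n+1..M+p}" using M by (cases "p \<le> n") auto
      ultimately show ?thesis by simp
    qed
    have 2: "(\<Prod>v\<in>{n+1..N+p+1}-{?u}. \<alpha> ?u - \<alpha> v)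
       = (\<Prod>a=n+1..M+p. \<alpha> ?u - \<alpha> a) * (\<Prod>k\<in>{M+1..N+1}-{i}. \<alpha> i - \<alpha> k)"
    proof -
      have "{n+1..N+p+1}-{?u} = {n+1..M+p} \<union> ({M+p+1..N+p+1}-{?u})"
        using i Mp N by auto
      moreover have "prod g ({n+1..M+p} \<union> ({M+p+1..N+p+1}-{?u})) = prod g {n+1..M+p} * prod g ({M+p+1..N+p+1}-{?u})"
        for g :: "nat \<Rightarrow> real"
        by (rule prod.union_disjoint) auto
      ultimately have "(\<Prod>v\<in>{n+1..N+p+1}-{?u}. \<alpha> ?u - \<alpha> v)
        = (\<Prod>a=n+1..M+p. \<alpha> ?u - \<alpha> a) * (\<Prod>v\<in>{M+p+1..N+p+1}-{?u}. \<alpha> ?u - \<alpha> v)"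
        by (simp only:)
      also have "(\<Prod>v\<in>{M+p+1..N+p+1}-{?u}. \<alpha> ?u - \<alpha> v) = (\<Prod>k\<in>{M+1..N+1}-{i}. \<alpha> i - \<alpha> k)"
        by (rule prod.reindex_bij_witness[symmetric, of _ "\<lambda>v. v - p" "\<lambda>k. k + p"])
          (use u in \<open>auto simp: \<alpha>_shift\<close>)
      finally show ?thesis .
    qed
    have nz: "(\<Prod>a=n+1..M+p. \<alpha> ?u - \<alpha> a) \<noteq> 0" using i by (auto simp: \<alpha>_eq_iff)
    have "poly (shifted_numerator n) (\<alpha> i)
      = mellin_const n * (\<Prod>a=1..min p n. \<alpha> ?u - \<alpha> a) * (\<Prod>j=1..q. \<alpha> ?u + \<beta> j)"
      unfolding poly_shifted_numerator u by (simp add: add_ac)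
    moreover have "(\<Prod>j=N+1..n+q+1. \<alpha> i - node j) = (\<Prod>j=N+1..n+q+1. \<alpha> ?u + \<beta> j)"
      unfolding diff_node u by (intro prod.cong) auto
    ultimately show "?t i = mellin_const n * \<alpha>_residue n N ?u"
      unfolding \<alpha>_residue_def 1 2 using nz by simp
  qed
  also have "\<dots> = mellin_const n * (\<Sum>i=M+1..N+1. \<alpha>_residue n N (i + p))"
    by (simp only: sum_distrib_left)
  also have "(\<Sum>i=M+1..N+1. \<alpha>_residue n N (i + p)) = (\<Sum>u=M+1+p..N+1+p. \<alpha>_residue n N u)"
    by (rule sum.shift_bounds_cl_nat_ivl[symmetric])
  also have "\<dots> = (\<Sum>u=n+1..N+p+1. \<alpha>_residue n N u)"
  proof (rule sum.mono_neutral_left)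
    show "\<forall>u\<in>{n+1..N+p+1} - {M+1+p..N+1+p}. \<alpha>_residue n N u = 0"
    proof
      fix u assume "u \<in> {n+1..N+p+1} - {M+1+p..N+1+p}"
      then have "u \<in> {1..p}" using M by auto
      then have "(\<Prod>a=1..p. \<alpha> u - \<alpha> a) = 0" by (intro prod_zero bexI[of _ u]) auto
      then show "\<alpha>_residue n N u = 0" by (simp add: \<alpha>_residue_def)
    qed
  qed (use M in auto)
  finally show ?thesis by (simp add: diff_node mult.assoc)
qed

text \<open>The sign collects min p n reversals in the numerator and j + 1 + min p n in the
  denominator, the latter being the number of nodes \<alpha>_i with M < i <= N + 1. Reversing the
  prefactor turns the resulting (-1)^(j+1) into (-1)^j.\<close>

lemma coefficient_\<beta>_residues:
  assumes N: "N = n + j" "j \<le> q"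
  shows "e N = (-1) ^ j * (\<alpha> (N + 1) + \<beta> (N + 1) + 1) * mellin_const n * (\<Sum>h=N+1..n+q+1. \<beta>_residue n N h)"
proof -
  let ?t = "\<lambda>h. poly (shifted_numerator n) (node h) /
     ((\<Prod>k\<in>{N+1..n+q+1}-{h}. node h - node k) * (\<Prod>i=M+1..N+1. node h - \<alpha> i))"
  have MN: "M \<le> N" "N \<le> n + q" using M N by auto
  have "e N = (node (N + 1) - \<alpha> (N + 1)) * (\<Sum>h=N+1..n+q+1. ?t h)"
    by (rule mixed_newton_coefficient_right[OF e MN])
      (auto intro!: inj_onI simp: node_neq_\<alpha> node_eq_iff)
  also have "(\<Sum>h=N+1..n+q+1. ?t h) = (\<Sum>h=N+1..n+q+1. (-1) ^ (j + 1) * mellin_const n * \<beta>_residue n N h)"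
  proof (intro sum.cong refl)
    fix h assume h: "h \<in> {N+1..n+q+1}"
    have 1: "poly (shifted_numerator n) (node h) = mellin_const n * ((-1) ^ min p n * (\<Prod>i=1..min p n. \<alpha> i + \<beta> h))
      * (\<Prod>j=1..q. \<beta> j - \<beta> h)"
    proof -
      have "(\<Prod>i=1..min p n. node h + 1 - \<alpha> i) = (-1) ^ min p n * (\<Prod>i=1..min p n. \<alpha> i + \<beta> h)"
        using prod_diff_swap[of "\<lambda>i. node h + 1" \<alpha> "{1..min p n}"] by (simp add: node_def)
      then show ?thesis unfolding poly_shifted_numerator by (simp add: node_def)
    qed
    have 2: "(\<Prod>k\<in>{N+1..n+q+1}-{h}. node h - node k) = (\<Prod>k\<in>{N+1..n+q+1}-{h}. \<beta> k - \<beta> h)"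
      by (simp add: node_def)
    have 3: "(\<Prod>i=M+1..N+1. node h - \<alpha> i) = (-1) ^ (j + 1 + min p n) * (\<Prod>i=M+1..N+1. \<alpha> i + \<beta> h + 1)"
    proof -
      have "card {M+1..N+1} = j + 1 + min p n" using M N by auto
      moreover have "\<alpha> i - node h = \<alpha> i + \<beta> h + 1" for i by (simp add: diff_node)
      ultimately show ?thesis using prod_diff_swap[of "\<lambda>i. node h" \<alpha> "{M+1..N+1}"] by (simp only:)
    qed
    have 4: "(\<Prod>i=1..n. \<alpha> i + \<beta> h) = (\<Prod>i=1..min p n. \<alpha> i + \<beta> h) * (\<Prod>i=1..M. \<alpha> i + \<beta> h + 1)"
      unfolding M using prod_\<alpha>_split[of "\<lambda>z. z + \<beta> h" n] by (simp add: add_ac)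
    have 5: "(\<Prod>i=1..N+1. \<alpha> i + \<beta> h + 1) = (\<Prod>i=1..M. \<alpha> i + \<beta> h + 1) * (\<Prod>i=M+1..N+1. \<alpha> i + \<beta> h + 1)"
      using prod_atLeastAtMost_split[of 1 M "N+1" "\<lambda>i. \<alpha> i + \<beta> h + 1"] MN by simp
    have "\<alpha> i + \<beta> h + 1 \<noteq> 0" if "i \<in> {1..M}" for i using sum_gt[of i h] h that by auto
    then have nz: "(\<Prod>i=1..M. \<alpha> i + \<beta> h + 1) \<noteq> 0" by auto
    have sgn: "((-1::real) ^ min p n) / (-1) ^ (j + 1 + min p n) = (-1) ^ (j + 1)"
      by (simp add: power_add field_simps power_mult_distrib[symmetric])
    have "?t h = mellin_const n * (((-1) ^ min p n) / (-1) ^ (j + 1 + min p n)) * ((\<Prod>i=1..min p n. \<alpha> i + \<beta> h) * (\<Prod>j=1..q. \<beta> j - \<beta> h)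
      / ((\<Prod>k\<in>{N+1..n+q+1}-{h}. \<beta> k - \<beta> h) * (\<Prod>i=M+1..N+1. \<alpha> i + \<beta> h + 1)))"
      unfolding 1 2 3 by (simp only: times_divide_eq_left times_divide_eq_right divide_divide_eq_left divide_divide_eq_right mult_ac)
    also have "((\<Prod>i=1..min p n. \<alpha> i + \<beta> h) * (\<Prod>j=1..q. \<beta> j - \<beta> h)
      / ((\<Prod>k\<in>{N+1..n+q+1}-{h}. \<beta> k - \<beta> h) * (\<Prod>i=M+1..N+1. \<alpha> i + \<beta> h + 1))) = \<beta>_residue n N h"
      unfolding \<beta>_residue_def 4 5 using nz by (simp del: prod.cl_ivl_Suc)
    finally show "?t h = (-1) ^ (j + 1) * mellin_const n * \<beta>_residue n N h"
      unfolding sgn by (simp only: mult_ac)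
  qed
  also have "\<dots> = (-1) ^ (j + 1) * mellin_const n * (\<Sum>h=N+1..n+q+1. \<beta>_residue n N h)"
    by (simp only: sum_distrib_left)
  finally show ?thesis by (simp add: node_def algebra_simps del: sum.cl_ivl_Suc)
qed

end

end

subsection \<open>The closed formulas\<close>


lemma prod_ipochhammer_ceiling:
  assumes q: "q \<ge> 1" and \<beta>: "unit_shift q \<beta>"
    and e: "\<And>h. h \<in> {1..q} \<Longrightarrow> e h = real N + 1 - real h - real q * real r"
  shows "(\<Prod>h=1..q. ipochhammer (\<beta> h + z) (int r + \<lceil>e h / real q\<rceil>)) = (\<Prod>h=1..N. \<beta> h + z)"
proof -
  have "(\<Prod>h=1..q. ipochhammer (\<beta> h + z) (int r + \<lceil>e h / real q\<rceil>))
    = (\<Prod>h=1..q. pochhammer (\<beta> h + z) (step_n q h N))"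
  proof (intro prod.cong refl)
    fix h assume "h \<in> {1..q}"
    then have "int r + \<lceil>e h / real q\<rceil> = int (step_n q h N)"
      by (intro ceiling_eq_step_n q e)
    then show "ipochhammer (\<beta> h + z) (int r + \<lceil>e h / real q\<rceil>) = pochhammer (\<beta> h + z) (step_n q h N)"
      by (simp add: ipochhammer_def)
  qed
  then show ?thesis using prod_pochhammer_step_n[OF q \<beta>] by simp
qed

text \<open>The two ceilings belong to consecutive step counts N and N + 1, so only the new factor
  with index N + 1 survives. This identifies the leading products of b^j and b^{-i} as the prefactor
  of the divided difference. Positivity licenses the cancellations, since the ceilings may be
  negative.\<close>

lemma prod_ipochhammer_ratio:
  assumes q: "q \<ge> 1" and \<beta>: "unit_shift q \<beta>" and pos: "\<And>h. h \<ge> 1 \<Longrightarrow> \<beta> h + z > 0"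
    and e: "\<And>h. h \<in> {1..q} \<Longrightarrow> e h = real N + 1 - real h - real q * real r"
    and e': "\<And>h. h \<in> {1..q} \<Longrightarrow> e' h = real N + 2 - real h - real q * real r"
    and w: "\<And>h. h \<in> {1..q} \<Longrightarrow> w h = \<beta> h + z + real r"
  shows "(\<Prod>h=1..q. ipochhammer (w h) \<lceil>e' h / real q\<rceil> / ipochhammer (w h) \<lceil>e h / real q\<rceil>)
    = \<beta> (N + 1) + z"
proof -
  have "(\<Prod>h=1..q. ipochhammer (w h) \<lceil>e' h / real q\<rceil> / ipochhammer (w h) \<lceil>e h / real q\<rceil>)
    = (\<Prod>h=1..q. pochhammer (\<beta> h + z) (step_n q h (Suc N)) / pochhammer (\<beta> h + z) (step_n q h N))"
  proof (intro prod.cong refl)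
    fix h assume h: "h \<in> {1..q}"
    have p: "\<beta> h + z > 0" using pos h by simp
    have 1: "int r + \<lceil>e h / real q\<rceil> = int (step_n q h N)"
      using h by (intro ceiling_eq_step_n q e)
    have 2: "int r + \<lceil>e' h / real q\<rceil> = int (step_n q h (Suc N))"
      using h e'[OF h] by (intro ceiling_eq_step_n q) auto
    have "pochhammer (\<beta> h + z) r \<noteq> 0" using pochhammer_pos[OF p, of r] by simp
    then show "ipochhammer (w h) \<lceil>e' h / real q\<rceil> / ipochhammer (w h) \<lceil>e h / real q\<rceil>
      = pochhammer (\<beta> h + z) (step_n q h (Suc N)) / pochhammer (\<beta> h + z) (step_n q h N)"
      unfolding w[OF h] ipochhammer_eq_divide[OF p 1] ipochhammer_eq_divide[OF p 2] by simp
  qed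
  also have "\<dots> = (\<Prod>h=1..Suc N. \<beta> h + z) / (\<Prod>h=1..N. \<beta> h + z)"
    unfolding prod_dividef prod_pochhammer_step_n[OF q \<beta>] ..
  also have "\<dots> = \<beta> (N + 1) + z"
  proof -
    have "\<beta> h + z \<noteq> 0" if "h \<in> {1..N}" for h using pos[of h] that by simp
    then have "(\<Prod>h=1..N. \<beta> h + z) \<noteq> 0" by auto
    then show ?thesis by simp
  qed
  finally show ?thesis .
qed

text \<open>Here all p symbols have equal length r but start at index c + 1: apply the step-line
  product to the tail of \<gamma> at N = p r, where every step count is r.\<close>

lemma prod_pochhammer_offset:
  assumes p: "p \<ge> 1" and \<gamma>: "unit_shift p \<gamma>"
  shows "(\<Prod>i=1..c. \<gamma> i + z) * (\<Prod>a=1..p. pochhammer (\<gamma> (c + a) + z) r) = (\<Prod>i=1..c + p * r. \<gamma> i + z)"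
proof -
  have "unit_shift p (\<lambda>a. \<gamma> (c + a))"
    unfolding unit_shift_def
  proof (intro allI impI)
    fix i :: nat assume "i \<ge> 1"
    then show "\<gamma> (c + (i + p)) = \<gamma> (c + i) + 1"
      using unit_shiftD[OF \<gamma>, of "c + i"] by (simp add: add.assoc)
  qed
  then have "(\<Prod>a=1..p. pochhammer (\<gamma> (c + a) + z) (step_n p a (p * r))) = (\<Prod>i=1..p * r. \<gamma> (c + i) + z)"
    by (rule prod_pochhammer_step_n[OF p])
  then have "(\<Prod>a=1..p. pochhammer (\<gamma> (c + a) + z) r) = (\<Prod>i=1..p * r. \<gamma> (c + i) + z)"
    using p by (simp add: step_n_mult)
  also have "\<dots> = (\<Prod>i=Suc c..c + p * r. \<gamma> i + z)"
    using prod.shift_bounds_cl_nat_ivl[of "\<lambda>i. \<gamma> i + z" 1 c "p * r"] by (simp add: add.commute)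
  finally show ?thesis using prod_atLeastAtMost_split[of 1 c "c + p * r" "\<lambda>i. \<gamma> i + z"] by simp
qed

context stepline_parameters
begin

context
  fixes n \<rr> \<ll> r l :: nat
  assumes n_p: "n = p * \<rr> + \<ll>" and \<ll>: "\<ll> < p" and n_q: "n = q * r + l" and l: "l < q"
begin

lemma \<alpha>_n: "k \<ge> 1 \<Longrightarrow> \<alpha> (\<ll> + k) = \<alpha> (n + k) - real \<rr>"
  using affine_index[OF shift_\<alpha>, of "\<ll> + k" \<rr>] by (simp add: n_p add.assoc mult.commute)

lemma \<beta>_n: "k \<ge> 1 \<Longrightarrow> \<beta> (l + k) = \<beta> (n + k) - real r"
  using affine_index[OF shift_\<beta>, of "l + k" r] by (simp add: n_q add.assoc mult.commute)

text \<open>Term by term under h = k + n + 1: the shifts by \<rr> and r move into the extended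
  indices, after which each summand is literally a \<beta> residue.\<close>

lemma upper_coefficient:
  assumes j: "j \<in> {1..q}"
  shows "(\<alpha> (n + j + 1) + \<beta> (n + j + 1) + 1) * (\<Sum>h=n+j+1..n+q+1. \<beta>_residue n (n + j) h) =
        (\<Prod>a=1..p.
             ipochhammer (\<alpha> a + \<beta> (l + 1 + j) + real r + 1 + real \<rr>)
               \<lceil>(real \<ll> + real j + 2 - real a) / real p\<rceil>
             / ipochhammer (\<alpha> a + \<beta> (l + 1 + j) + real r + 1 + real \<rr>)
               \<lceil>(real \<ll> + real j + 1 - real a) / real p\<rceil>)
        * (\<Sum>k=j..q.
             (\<Prod>a=1..\<ll>. \<alpha> a + \<beta> (k + l + 1) + real r)
             * (\<Prod>a=1..p.
                  pochhammer (\<alpha> (a + \<ll>) + \<beta> (k + l + 1) + real r) \<rr>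
                  / ipochhammer (\<alpha> a + \<beta> (k + l + 1) + real r + 1)
                      (int \<rr> + \<lceil>(real \<ll> + real j + 2 - real a) / real p\<rceil>))
             * ((\<Prod>h=1..q. \<beta> h - \<beta> (k + l + 1) - real r)
                / (\<Prod>h\<in>{j..q} - {k}. \<beta> (h + l + 1) - \<beta> (k + l + 1))))"
proof -
  have "(\<Prod>a=1..p.
             ipochhammer (\<alpha> a + \<beta> (l + 1 + j) + real r + 1 + real \<rr>)
               \<lceil>(real \<ll> + real j + 2 - real a) / real p\<rceil>
             / ipochhammer (\<alpha> a + \<beta> (l + 1 + j) + real r + 1 + real \<rr>)
               \<lceil>(real \<ll> + real j + 1 - real a) / real p\<rceil>) = \<alpha> (n + j + 1) + (\<beta> (n + j + 1) + 1)"
  proof (rule prod_ipochhammer_ratio[OF p shift_\<alpha>])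
    show "\<alpha> h + (\<beta> (n + j + 1) + 1) > 0" if "h \<ge> 1" for h
      using sum_gt[of h "n + j + 1"] that by simp
    show "\<alpha> h + \<beta> (l + 1 + j) + real r + 1 + real \<rr> = \<alpha> h + (\<beta> (n + j + 1) + 1) + real \<rr>" for h
      using \<beta>_n[of "1 + j"] by (simp add: add_ac)
  qed (auto simp: n_p)
  moreover have "(\<Sum>h=n+j+1..n+q+1. \<beta>_residue n (n + j) h) = (\<Sum>k=j..q.
             (\<Prod>a=1..\<ll>. \<alpha> a + \<beta> (k + l + 1) + real r)
             * (\<Prod>a=1..p.
                  pochhammer (\<alpha> (a + \<ll>) + \<beta> (k + l + 1) + real r) \<rr>
                  / ipochhammer (\<alpha> a + \<beta> (k + l + 1) + real r + 1)
                      (int \<rr> + \<lceil>(real \<ll> + real j + 2 - real a) / real p\<rceil>))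
             * ((\<Prod>h=1..q. \<beta> h - \<beta> (k + l + 1) - real r)
                / (\<Prod>h\<in>{j..q} - {k}. \<beta> (h + l + 1) - \<beta> (k + l + 1))))" (is "?S = sum ?t _")
  proof -
    have "?S = (\<Sum>k=j..q. \<beta>_residue n (n + j) (k + (n + 1)))"
      using sum.shift_bounds_cl_nat_ivl[of "\<beta>_residue n (n + j)" j "n + 1" q] by (simp add: add_ac)
    also have "\<dots> = (\<Sum>k=j..q. ?t k)"
    proof (intro sum.cong refl)
      fix k assume k: "k \<in> {j..q}"
      define b where "b = \<beta> (k + (n + 1))"
      have b: "\<beta> (k + l + 1) = b - real r"
        using \<beta>_n[of "k + 1"] by (simp add: b_def add_ac)
      have b': "y + \<beta> (k + l + 1) + real r = y + b" for y unfolding b by simp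
      have 1: "(\<Prod>a=1..\<ll>. \<alpha> a + \<beta> (k + l + 1) + real r)
          * (\<Prod>a=1..p. pochhammer (\<alpha> (a + \<ll>) + \<beta> (k + l + 1) + real r) \<rr>)
          = (\<Prod>i=1..n. \<alpha> i + b)"
        unfolding b' using prod_pochhammer_offset[OF p shift_\<alpha>, where c=\<ll> and z=b and r=\<rr>] by (simp add: n_p add_ac)
      have 2: "(\<Prod>a=1..p. ipochhammer (\<alpha> a + \<beta> (k + l + 1) + real r + 1)
            (int \<rr> + \<lceil>(real \<ll> + real j + 2 - real a) / real p\<rceil>)) = (\<Prod>i=1..n + j + 1. \<alpha> i + b + 1)"
        unfolding b' using prod_ipochhammer_ceiling[OF p shift_\<alpha>, of "\<lambda>a. real \<ll> + real j + 2 - real a" "n + j + 1" \<rr> "b + 1"]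
        by (simp add: n_p add_ac)
      have 3: "(\<Prod>h\<in>{j..q} - {k}. \<beta> (h + l + 1) - \<beta> (k + l + 1))
         = (\<Prod>h\<in>{n + j + 1..n + q + 1} - {k + (n + 1)}. \<beta> h - b)"
      proof (rule prod.reindex_bij_witness[of _ "\<lambda>h. h - (n + 1)" "\<lambda>h. h + (n + 1)"])
        fix h
        show "\<beta> (h + (n + 1)) - b = \<beta> (h + l + 1) - \<beta> (k + l + 1)"
          unfolding b using \<beta>_n[of "h + 1"] by (simp add: add_ac)
      qed (use k in auto)
      have 4: "(\<Prod>h=1..q. \<beta> h - \<beta> (k + l + 1) - real r) = (\<Prod>h=1..q. \<beta> h - b)"
        unfolding b by simp
      have "?t k = ((\<Prod>a=1..\<ll>. \<alpha> a + \<beta> (k + l + 1) + real r)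
          * (\<Prod>a=1..p. pochhammer (\<alpha> (a + \<ll>) + \<beta> (k + l + 1) + real r) \<rr>))
          / (\<Prod>a=1..p. ipochhammer (\<alpha> a + \<beta> (k + l + 1) + real r + 1)
            (int \<rr> + \<lceil>(real \<ll> + real j + 2 - real a) / real p\<rceil>))
          * ((\<Prod>h=1..q. \<beta> h - \<beta> (k + l + 1) - real r)
                / (\<Prod>h\<in>{j..q} - {k}. \<beta> (h + l + 1) - \<beta> (k + l + 1)))"
        unfolding prod_dividef by (simp only: times_divide_eq_right)
      also have "\<dots> = \<beta>_residue n (n + j) (k + (n + 1))"
        unfolding 1 2 3 4 \<beta>_residue_def b_def[symmetric]
        by (simp add: mult_ac del: prod.cl_ivl_Suc)
      finally show "\<beta>_residue n (n + j) (k + (n + 1)) = ?t k" ..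
    qed
    finally show ?thesis .
  qed
  ultimately show ?thesis by (simp only: add.assoc)
qed

lemma middle_coefficient:
  "(\<alpha> (n + 1) + \<beta> (n + 1) + 1) * (\<Sum>u=n+1..n+p+1. \<alpha>_residue n n u) =
        (\<Prod>h=1..q. (\<alpha> (\<ll> + 1) + \<beta> h + real \<rr> + 1)
                    / (\<alpha> (\<ll> + 1) + \<beta> (l + 1 + h) + real r + real \<rr> + 1))
        * (\<Prod>a=1..p. (\<alpha> a - \<alpha> (\<ll> + 1) - real \<rr> - 1)
                      / (\<alpha> (\<ll> + a) - \<alpha> (\<ll> + 1) - 1))
        + (\<Sum>k=1..p.
             (\<alpha> (\<ll> + 1) + \<beta> (l + 1) + real \<rr> + real r + 1)
             / ((\<alpha> (\<ll> + k) + \<beta> (l + 1) + real \<rr> + real r)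
                * (\<alpha> (\<ll> + 1) - \<alpha> (\<ll> + k) + 1))
             * (\<Prod>h=1..q. (\<alpha> (\<ll> + k) + \<beta> h + real \<rr>)
                           / (\<alpha> (\<ll> + k) + \<beta> (l + 1 + h) + real \<rr> + real r))
             * ((\<Prod>a=1..p. \<alpha> a - \<alpha> (\<ll> + k) - real \<rr>)
                / (\<Prod>a\<in>{1..p} - {k}. \<alpha> (\<ll> + a) - \<alpha> (\<ll> + k))))"
    (is "?A * _ = ?P1 * ?P2 + (\<Sum>k=1..p. ?t k)")
proof -
  have one: "\<alpha> (Suc \<ll>) = \<alpha> (Suc n) - real \<rr>" "\<beta> (Suc l) = \<beta> (Suc n) - real r"
    "\<And>h. \<beta> (Suc (l + h)) = \<beta> (Suc (n + h)) - real r"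
    using \<alpha>_n[of 1] \<beta>_n[of 1] \<beta>_n[of "Suc _"] by simp_all
  have tail: "(\<Prod>j=n+1..n+q+1. x + \<beta> j) = (x + \<beta> (n + 1)) * (\<Prod>h=1..q. x + \<beta> (n + 1 + h))" for x
  proof -
    have "(\<Prod>j=n+1..n+q+1. x + \<beta> j) = (x + \<beta> (n + 1)) * (\<Prod>j=Suc (n+1)..n+q+1. x + \<beta> j)"
      by (rule prod.atLeast_Suc_atMost) simp
    also have "(\<Prod>j=Suc (n+1)..n+q+1. x + \<beta> j) = (\<Prod>h=1..q. x + \<beta> (n + 1 + h))"
      using prod.shift_bounds_cl_nat_ivl[of "\<lambda>j. x + \<beta> j" 1 "n + 1" q] by (simp add: add_ac)
    finally show ?thesis .
  qed
  \<comment> \<open>The last node gives the separate product in b^0. There x + \<beta>_{n+1} equals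
    the prefactor \<open>?A\<close> and is positive, so the two cancel.\<close>
  have top: "?A * \<alpha>_residue n n (n + p + 1) = ?P1 * ?P2"
  proof -
    define x where "x = \<alpha> (n + 1) + 1"
    have x: "\<alpha> (n + p + 1) = x" using \<alpha>_shift[of "n + 1"] by (simp add: x_def add_ac)
    have A: "?A = x + \<beta> (n + 1)" by (simp add: x_def)
    have "x + \<beta> (n + 1) \<noteq> 0" using sum_gt[of "n+1" "n+1"] by (simp add: x_def)
    moreover have "{n+1..n+p+1} - {n+p+1} = {n+1..n+p}" by auto
    ultimately have "?A * \<alpha>_residue n n (n + p + 1) = (\<Prod>a=1..p. x - \<alpha> a) * (\<Prod>j=1..q. x + \<beta> j) /
        ((\<Prod>v=n+1..n+p. x - \<alpha> v) * (\<Prod>h=1..q. x + \<beta> (n + 1 + h)))"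
      unfolding \<alpha>_residue_def x tail A by (simp del: prod.cl_ivl_Suc)
    also have "(\<Prod>v=n+1..n+p. x - \<alpha> v) = (\<Prod>a=1..p. x - \<alpha> (n + a))"
      using prod.shift_bounds_cl_nat_ivl[of "\<lambda>v. x - \<alpha> v" 1 n p] by (simp add: add_ac)
    also have "(\<Prod>a=1..p. x - \<alpha> a) * (\<Prod>j=1..q. x + \<beta> j) /
        ((\<Prod>a=1..p. x - \<alpha> (n + a)) * (\<Prod>h=1..q. x + \<beta> (n + 1 + h)))
      = (\<Prod>h=1..q. (x + \<beta> h) / (x + \<beta> (n + 1 + h))) * (\<Prod>a=1..p. (x - \<alpha> a) / (x - \<alpha> (n + a)))"
      unfolding prod_dividef by (simp add: mult_ac)
    also have "(\<Prod>h=1..q. (x + \<beta> h) / (x + \<beta> (n + 1 + h))) = ?P1"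
      by (intro prod.cong refl arg_cong2[of _ _ _ _ "(/)"]) (simp_all add: x_def one)
    also have "(\<Prod>a=1..p. (x - \<alpha> a) / (x - \<alpha> (n + a))) = ?P2"
    proof (intro prod.cong refl)
      fix a assume "a \<in> {1..p}"
      then have "\<alpha> a - \<alpha> (\<ll> + 1) - real \<rr> - 1 = - (x - \<alpha> a)"
        "\<alpha> (\<ll> + a) - \<alpha> (\<ll> + 1) - 1 = - (x - \<alpha> (n + a))"
        by (simp_all add: x_def one \<alpha>_n)
      then show "(x - \<alpha> a) / (x - \<alpha> (n + a)) = (\<alpha> a - \<alpha> (\<ll> + 1) - real \<rr> - 1) / (\<alpha> (\<ll> + a) - \<alpha> (\<ll> + 1) - 1)"
        by (simp only: minus_divide_divide)
    qed
    finally show ?thesis .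
  qed
  \<comment> \<open>Both sides have the same possibly vanishing denominators x + \<beta>_j, and only
    the powers of -1 are cancelled, so the equality also holds where division by zero yields
    0.\<close>
  have rest: "?A * \<alpha>_residue n n (k + n) = ?t k" if k: "k \<in> {1..p}" for k
  proof -
    define x where "x = \<alpha> (n + k)"
    have x: "\<alpha> (k + n) = x" by (simp add: x_def add.commute)
    have lk: "\<alpha> (\<ll> + k) = x - real \<rr>" using \<alpha>_n[of k] k by (simp add: x_def)
    have 1: "(\<Prod>v\<in>{n+1..n+p+1}-{k + n}. x - \<alpha> v) = (x - \<alpha> (n + 1) - 1) * (\<Prod>a\<in>{1..p} - {k}. x - \<alpha> (n + a))"
    proof -
      have "{n+1..n+p+1}-{k + n} = insert (n + p + 1) ({n+1..n+p}-{k + n})" using k by auto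
      moreover have "prod g (insert (n + p + 1) ({n+1..n+p}-{k + n})) = g (n + p + 1) * prod g ({n+1..n+p}-{k + n})"
        for g :: "nat \<Rightarrow> real" by (rule prod.insert) auto
      ultimately have "(\<Prod>v\<in>{n+1..n+p+1}-{k + n}. x - \<alpha> v)
        = (x - \<alpha> (n + p + 1)) * (\<Prod>v\<in>{n+1..n+p}-{k + n}. x - \<alpha> v)" by (simp only:)
      also have "(\<Prod>v\<in>{n+1..n+p}-{k + n}. x - \<alpha> v) = (\<Prod>a\<in>{1..p} - {k}. x - \<alpha> (n + a))"
        by (rule prod.reindex_bij_witness[symmetric, of _ "\<lambda>v. v - n" "\<lambda>a. n + a"]) auto
      also have "\<alpha> (n + p + 1) = \<alpha> (n + 1) + 1" using \<alpha>_shift[of "n + 1"] by (simp add: add_ac)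
      finally show ?thesis by (simp add: diff_diff_eq)
    qed
    have cp: "card ({1..p} - {k}) = p - 1" using k by simp
    have 2: "(\<Prod>a=1..p. \<alpha> a - \<alpha> (\<ll> + k) - real \<rr>) = (-1) ^ p * (\<Prod>a=1..p. x - \<alpha> a)"
      using prod_diff_swap[of \<alpha> "\<lambda>_. x" "{1..p}"] by (simp add: lk diff_diff_eq)
    have 3: "(\<Prod>a\<in>{1..p} - {k}. \<alpha> (\<ll> + a) - \<alpha> (\<ll> + k)) = (-1) ^ (p - 1) * (\<Prod>a\<in>{1..p} - {k}. x - \<alpha> (n + a))"
      using prod_diff_swap[of "\<lambda>a. \<alpha> (n + a)" "\<lambda>_. x" "{1..p} - {k}", unfolded cp] by (simp add: lk \<alpha>_n)
    have 4: "\<alpha> (\<ll> + 1) - \<alpha> (\<ll> + k) + 1 = - (x - \<alpha> (n + 1) - 1)" by (simp add: lk one)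
    have 5: "(-1::real) ^ p = - ((-1) ^ (p - 1))" using p by (cases p) auto
    have 6: "(\<Prod>h=1..q. (\<alpha> (\<ll> + k) + \<beta> h + real \<rr>) / (\<alpha> (\<ll> + k) + \<beta> (l + 1 + h) + real \<rr> + real r))
      = (\<Prod>h=1..q. x + \<beta> h) / (\<Prod>h=1..q. x + \<beta> (n + 1 + h))"
      unfolding prod_dividef[symmetric] by (intro prod.cong refl arg_cong2[of _ _ _ _ "(/)"]) (simp_all add: lk one)
    have 7: "\<alpha> (\<ll> + k) + \<beta> (l + 1) + real \<rr> + real r = x + \<beta> (n + 1)"
      "\<alpha> (\<ll> + 1) + \<beta> (l + 1) + real \<rr> + real r + 1 = ?A"
      by (simp_all add: lk one)
    have "?t k = ?A / ((x + \<beta> (n + 1)) * - (x - \<alpha> (n + 1) - 1)) * ((\<Prod>h=1..q. x + \<beta> h) / (\<Prod>h=1..q. x + \<beta> (n + 1 + h)))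
       * (- ((-1) ^ (p - 1)) * (\<Prod>a=1..p. x - \<alpha> a) / ((-1) ^ (p - 1) * (\<Prod>a\<in>{1..p} - {k}. x - \<alpha> (n + a))))"
      unfolding 2 3 4 6 7 5 ..
    also have "\<dots> = ?A * \<alpha>_residue n n (k + n)"
    proof -
      obtain y where y: "x - \<alpha> (n + 1) - 1 = y" by simp
      show ?thesis unfolding \<alpha>_residue_def x tail 1 y by (simp add: mult_ac)
    qed
    finally show ?thesis ..
  qed
  have "(\<Sum>u=n+1..n+p+1. \<alpha>_residue n n u) = (\<Sum>u=1+n..p+n. \<alpha>_residue n n u) + \<alpha>_residue n n (n + p + 1)"
    by (simp add: add.commute)
  also have "(\<Sum>u=1+n..p+n. \<alpha>_residue n n u) = (\<Sum>k=1..p. \<alpha>_residue n n (k + n))"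
    by (rule sum.shift_bounds_cl_nat_ivl)
  finally have "?A * (\<Sum>u=n+1..n+p+1. \<alpha>_residue n n u)
     = ?A * \<alpha>_residue n n (n + p + 1) + (\<Sum>k=1..p. ?A * \<alpha>_residue n n (k + n))"
    by (simp add: distrib_left sum_distrib_left)
  then show ?thesis unfolding top using rest by simp
qed

text \<open>The summand k corresponds to u = n + p + 1 - k. The factor (-1)^i in front comes from
  the ratio of Mellin constants and is absorbed by the sign reversals in the products over
  \<alpha>.\<close>

lemma lower_coefficient:
  assumes i: "i \<in> {1..min p n}"
  shows "(-1) ^ i * (\<alpha> (n - i + 1) + \<beta> (n - i + 1) + 1) * (\<Sum>u=n+1..n-i+p+1. \<alpha>_residue n (n - i) u) =
        (\<Prod>h=1..q.
             ipochhammer (\<alpha> (p + \<ll> - i + 1) + \<beta> h + real \<rr> + real r)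
               \<lceil>(real l + 2 - real i - real h) / real q\<rceil>
             / ipochhammer (\<alpha> (p + \<ll> - i + 1) + \<beta> h + real \<rr> + real r)
               \<lceil>(real l + 1 - real i - real h) / real q\<rceil>)
        * (\<Sum>k=i..p.
             (\<Prod>h=1..l + 1. 1 / (\<alpha> (p + \<ll> - k + 1) + \<beta> h + real \<rr> + 1))
             * ((\<Prod>h=1..q.
                   ipochhammer (\<alpha> (p + \<ll> - k + 1) + \<beta> h + real \<rr>)
                     (int r + \<lceil>(real l + 1 - real i - real h) / real q\<rceil>)
                   / pochhammer (\<alpha> (p + \<ll> - k + 1) + \<beta> (l + 1 + h) + real \<rr> + 1) r)
                * (\<Prod>a=1..p. \<alpha> a - \<alpha> (p + \<ll> - k + 1) - real \<rr>)
                / (\<Prod>a\<in>{i..p} - {k}.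
                     \<alpha> (p + \<ll> - a + 1) - \<alpha> (p + \<ll> - k + 1))))"
    (is "_ = ?R * (\<Sum>k=i..p. ?t k)")
proof -
  have \<alpha>1: "\<alpha> (p + \<ll> - k + 1) = \<alpha> (n + p + 1 - k) - real \<rr>" if "k \<le> p" for k
    using \<alpha>_n[of "p - k + 1"] that by (simp add: Suc_diff_le add_ac)
  have i': "1 \<le> i" "i \<le> p" "i \<le> n" using i by auto
  have up: "\<alpha> (n + p + 1 - i) = \<alpha> (n - i + 1) + 1"
    using \<alpha>_shift[of "n - i + 1"] i' by (simp add: add_ac Suc_diff_le)
  have R: "?R = \<beta> (n - i + 1) + (\<alpha> (n - i + 1) + 1)"
  proof (rule prod_ipochhammer_ratio[OF q shift_\<beta>])
    show "\<beta> h + (\<alpha> (n - i + 1) + 1) > 0" if "h \<ge> 1" for h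
      using sum_gt[of "n - i + 1" h] that by simp
    show "\<alpha> (p + \<ll> - i + 1) + \<beta> h + real \<rr> + real r = \<beta> h + (\<alpha> (n - i + 1) + 1) + real r" for h
      using \<alpha>1[of i] up i' by simp
  qed (use i' in \<open>auto simp: n_q of_nat_diff\<close>)
  have t: "?t k = (-1) ^ i * \<alpha>_residue n (n - i) (n + p + 1 - k)" if k: "k \<in> {i..p}" for k
  proof -
    let ?u = "n + p + 1 - k"
    define x where "x = \<alpha> ?u"
    have x: "\<alpha> (p + \<ll> - k + 1) = x - real \<rr>" using \<alpha>1[of k] k by (simp add: x_def)
    have 2: "(\<Prod>a=1..p. \<alpha> a - \<alpha> (p + \<ll> - k + 1) - real \<rr>) = (-1) ^ p * (\<Prod>a=1..p. x - \<alpha> a)"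
      using prod_diff_swap[of \<alpha> "\<lambda>_. x" "{1..p}"] unfolding x by simp
    show ?thesis
    \<comment> \<open>The quotients are rearranged below, which needs x + \<beta>_j nonzero. This
      can fail only for \<open>?u\<close> <= p, where a zero factor in the numerators makes both
      sides 0.\<close>
    proof (cases "?u \<le> p")
      case True
      then have "?u \<in> {1..p}" using k by auto
      then have z: "(\<Prod>a=1..p. x - \<alpha> a) = 0" unfolding x_def by (intro prod_zero bexI[of _ ?u]) auto
      show ?thesis unfolding 2 \<alpha>_residue_def x_def[symmetric] z by simp
    next
      case False
      have pos: "x + \<beta> j > 0" if "j \<ge> 1" for j
        using sum_pos_if_gt[of ?u j] False that by (simp add: x_def)
      have 3: "(\<Prod>a\<in>{i..p} - {k}. \<alpha> (p + \<ll> - a + 1) - \<alpha> (p + \<ll> - k + 1))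
        = (-1) ^ (p - i) * (\<Prod>v\<in>{n+1..n-i+p+1}-{?u}. x - \<alpha> v)"
      proof -
        have "(\<Prod>a\<in>{i..p} - {k}. \<alpha> (p + \<ll> - a + 1) - \<alpha> (p + \<ll> - k + 1))
          = (\<Prod>v\<in>{n+1..n-i+p+1}-{?u}. \<alpha> v - x)"
        proof (rule prod.reindex_bij_witness[of _ "\<lambda>v. n + p + 1 - v" "\<lambda>a. n + p + 1 - a"])
          fix a assume "a \<in> {i..p} - {k}"
          then show "\<alpha> (n + p + 1 - a) - x = \<alpha> (p + \<ll> - a + 1) - \<alpha> (p + \<ll> - k + 1)"
            using \<alpha>1[of a] x by simp
        qed (use k i' in auto)
        moreover have "card ({n+1..n-i+p+1}-{?u}) = p - i" using k i' by (subst card_Diff_singleton) auto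
        ultimately show ?thesis using prod_diff_swap[of \<alpha> "\<lambda>_. x" "{n+1..n-i+p+1}-{?u}"] by (simp only:)
      qed
      have 4: "(\<Prod>h=1..q. ipochhammer (\<alpha> (p + \<ll> - k + 1) + \<beta> h + real \<rr>)
          (int r + \<lceil>(real l + 1 - real i - real h) / real q\<rceil>)) = (\<Prod>h=1..n-i. x + \<beta> h)"
        unfolding x using prod_ipochhammer_ceiling[OF q shift_\<beta>, of "\<lambda>h. real l + 1 - real i - real h" "n - i" r x] i'
        by (simp add: n_q of_nat_diff add_ac)
      have 5: "(\<Prod>h=1..l+1. \<alpha> (p + \<ll> - k + 1) + \<beta> h + real \<rr> + 1)
          * (\<Prod>h=1..q. pochhammer (\<alpha> (p + \<ll> - k + 1) + \<beta> (l + 1 + h) + real \<rr> + 1) r)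
          = (\<Prod>j=q+1..n+q+1. x + \<beta> j)"
      proof -
        have "(\<Prod>h=1..l+1. \<alpha> (p + \<ll> - k + 1) + \<beta> h + real \<rr> + 1)
          * (\<Prod>h=1..q. pochhammer (\<alpha> (p + \<ll> - k + 1) + \<beta> (l + 1 + h) + real \<rr> + 1) r)
          = (\<Prod>h=1..n+1. \<beta> h + (x + 1))"
          unfolding x using prod_pochhammer_offset[OF q shift_\<beta>, where c="l + 1" and z="x + 1" and r=r]
          by (simp add: n_q add_ac del: prod.cl_ivl_Suc)
        also have "\<dots> = (\<Prod>h=1..n+1. x + \<beta> (h + q))"
          by (intro prod.cong refl) (auto simp: \<beta>_shift)
        also have "\<dots> = (\<Prod>j=q+1..n+q+1. x + \<beta> j)"
          using prod.shift_bounds_cl_nat_ivl[of "\<lambda>j. x + \<beta> j" 1 q "n + 1"] by (simp add: add_ac del: prod.cl_ivl_Suc)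
        finally show ?thesis .
      qed
      \<comment> \<open>Both sides come from splitting the product over 1..n+q+1, once after q and
        once after n - i.\<close>
      have 6: "(\<Prod>j=1..q. x + \<beta> j) / (\<Prod>j=n-i+1..n+q+1. x + \<beta> j) = (\<Prod>j=1..n-i. x + \<beta> j) / (\<Prod>j=q+1..n+q+1. x + \<beta> j)"
      proof -
        have "(\<Prod>j=1..q. x + \<beta> j) * (\<Prod>j=q+1..n+q+1. x + \<beta> j) = (\<Prod>j=1..n-i. x + \<beta> j) * (\<Prod>j=n-i+1..n+q+1. x + \<beta> j)"
          using prod_atLeastAtMost_split[of 1 q "n+q+1" "\<lambda>j. x + \<beta> j"] prod_atLeastAtMost_split[of 1 "n-i" "n+q+1" "\<lambda>j. x + \<beta> j"]
          by (simp del: prod.cl_ivl_Suc)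
        moreover have "(\<Prod>j=a+1..n+q+1. x + \<beta> j) \<noteq> 0" for a
        proof -
          have "x + \<beta> j \<noteq> 0" if "j \<in> {a+1..n+q+1}" for j using pos[of j] that by simp
          then show ?thesis by (simp only: prod_zero_iff finite_atLeastAtMost) blast
        qed
        ultimately show ?thesis by (simp only: frac_eq_eq mult_ac not_False_eq_True)
      qed
      have sgn: "(-1::real) ^ p / (-1) ^ (p - i) = (-1) ^ i"
        using i' by (simp add: power_diff field_simps)
      have "?t k = (1 / (\<Prod>h=1..l+1. \<alpha> (p + \<ll> - k + 1) + \<beta> h + real \<rr> + 1))
         * ((\<Prod>h=1..n-i. x + \<beta> h) / (\<Prod>h=1..q. pochhammer (\<alpha> (p + \<ll> - k + 1) + \<beta> (l + 1 + h) + real \<rr> + 1) r)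
         * ((-1) ^ p * (\<Prod>a=1..p. x - \<alpha> a)) / ((-1) ^ (p - i) * (\<Prod>v\<in>{n+1..n-i+p+1}-{?u}. x - \<alpha> v)))"
        unfolding prod_dividef 2 3 4 by (simp only: prod.neutral_const)
      also have "\<dots> = ((-1) ^ p / (-1) ^ (p - i)) * ((\<Prod>a=1..p. x - \<alpha> a) / (\<Prod>v\<in>{n+1..n-i+p+1}-{?u}. x - \<alpha> v)
         * ((\<Prod>h=1..n-i. x + \<beta> h) / ((\<Prod>h=1..l+1. \<alpha> (p + \<ll> - k + 1) + \<beta> h + real \<rr> + 1)
          * (\<Prod>h=1..q. pochhammer (\<alpha> (p + \<ll> - k + 1) + \<beta> (l + 1 + h) + real \<rr> + 1) r))))"
        by (simp only: times_divide_eq_left times_divide_eq_right divide_divide_eq_left divide_divide_eq_right mult_ac mult_1_left mult_1_right)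
      also have "\<dots> = (-1) ^ i * \<alpha>_residue n (n - i) ?u"
        unfolding sgn 5 6[symmetric] \<alpha>_residue_def x_def[symmetric]
        by (simp only: times_divide_eq_left times_divide_eq_right divide_divide_eq_left mult_ac)
      finally show ?thesis .
    qed
  qed
  have "(\<Sum>k=i..p. ?t k) = (\<Sum>k=i..p. (-1) ^ i * \<alpha>_residue n (n - i) (n + p + 1 - k))"
    by (intro sum.cong refl t)
  also have "\<dots> = (-1) ^ i * (\<Sum>k=i..p. \<alpha>_residue n (n - i) (n + p + 1 - k))"
    by (simp only: sum_distrib_left)
  also have "(\<Sum>k=i..p. \<alpha>_residue n (n - i) (n + p + 1 - k)) = (\<Sum>u=n+1..n-i+p+1. \<alpha>_residue n (n - i) u)"
    by (rule sum.reindex_bij_witness[of _ "\<lambda>u. n + p + 1 - u" "\<lambda>k. n + p + 1 - k"]) (use i' in auto)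
  finally show ?thesis unfolding R by (simp only: mult_ac add_ac)
qed

end

end

lemma index_mod_div:
  fixes i p :: nat
  assumes "i \<ge> 1"
  shows "i = (i - 1) div p * p + ((i - 1) mod p + 1)"
  using div_mult_mod_eq[of "i - 1" p] assms by linarith

lemma unit_shiftI:
  assumes p: "p \<ge> 1" and \<gamma>: "\<And>s i. i \<in> {1..p} \<Longrightarrow> \<gamma> (s * p + i) = \<gamma> i + real s"
  shows "unit_shift p \<gamma>"
  unfolding unit_shift_def
proof (intro allI impI)
  fix i :: nat assume i: "i \<ge> 1"
  let ?s = "(i - 1) div p" and ?a = "(i - 1) mod p + 1"
  have a: "?a \<in> {1..p}" using p by (auto simp: Suc_leI)
  have "\<gamma> (i + p) = \<gamma> (Suc ?s * p + ?a)"
    using index_mod_div[OF i, of p] by (simp add: add_ac)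
  also have "\<dots> = \<gamma> (?s * p + ?a) + 1" using \<gamma>[OF a, of "Suc ?s"] \<gamma>[OF a, of ?s] by simp
  also have "?s * p + ?a = i" using index_mod_div[OF i, of p] by simp
  finally show "\<gamma> (i + p) = \<gamma> i + 1" .
qed

text \<open>Equal values make the base values differ by an integer, so the residue classes agree;
  then the integer shifts agree as well.\<close>

lemma unit_shift_inj_on:
  assumes p: "p \<ge> 1" and \<gamma>: "unit_shift p \<gamma>"
    and nint: "\<And>i h. i \<in> {1..p} \<Longrightarrow> h \<in> {1..p} \<Longrightarrow> i \<noteq> h \<Longrightarrow> \<gamma> i - \<gamma> h \<notin> \<int>"
  shows "inj_on \<gamma> {1..}"
proof (rule inj_onI)
  fix i h :: nat assume "i \<in> {1..}" "h \<in> {1..}" and eq: "\<gamma> i = \<gamma> h"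
  then have i: "i \<ge> 1" and h: "h \<ge> 1" by auto
  let ?a = "(i - 1) mod p + 1" and ?c = "(h - 1) mod p + 1"
  let ?s = "(i - 1) div p" and ?t = "(h - 1) div p"
  have mem: "?a \<in> {1..p}" "?c \<in> {1..p}" using p by (auto simp: Suc_leI)
  have "\<gamma> i = \<gamma> ?a + real ?s" "\<gamma> h = \<gamma> ?c + real ?t"
    using affine_index_mod_div[OF \<gamma>, of "i - 1"] affine_index_mod_div[OF \<gamma>, of "h - 1"] i h by auto
  then have d: "\<gamma> ?a - \<gamma> ?c = of_int (int ?t - int ?s)" using eq by simp
  then have "\<gamma> ?a - \<gamma> ?c \<in> \<int>" by (simp only: Ints_of_int)
  then have ac: "?a = ?c" using nint[OF mem] by blast
  then have "real ?t = real ?s" using d by simp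
  then have "?t = ?s" by (simp only: of_nat_eq_iff)
  then show "i = h" using index_mod_div[OF i, of p] index_mod_div[OF h, of p] ac by metis
qed

theorem corollary5p21:
  fixes p q n \<rr> \<ll> r l :: nat
    and \<alpha> \<beta> :: "nat \<Rightarrow> real"
    and B :: "int \<Rightarrow> nat \<Rightarrow> real poly"
  assumes "p \<ge> 1" and "q \<ge> 1"
    and "\<And>i. i \<in> {1..p} \<Longrightarrow> \<alpha> i > -1"
    and "\<And>j. j \<in> {1..q} \<Longrightarrow> \<beta> j > -1"
    and "\<And>i j. i \<in> {1..p} \<Longrightarrow> j \<in> {1..q} \<Longrightarrow> \<alpha> i + \<beta> j > -1"
    and "\<And>i h. i \<in> {1..p} \<Longrightarrow> h \<in> {1..p} \<Longrightarrow> i \<noteq> h \<Longrightarrow> \<alpha> i - \<alpha> h \<notin> \<int>"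
    and "\<And>j s. j \<in> {1..q} \<Longrightarrow> s \<in> {1..q} \<Longrightarrow> j \<noteq> s \<Longrightarrow> \<beta> j - \<beta> s \<notin> \<int>"
    and "\<And>s i. i \<in> {1..p} \<Longrightarrow> \<alpha> (s * p + i) = \<alpha> i + real s"
    and "\<And>s j. j \<in> {1..q} \<Longrightarrow> \<beta> (s * q + j) = \<beta> j + real s"
    and "\<And>N::nat. monic_stepline_form p q \<alpha> \<beta> N (B (int N))"
    and "\<And>N j. N < 0 \<Longrightarrow> B N j = 0"
    and "n = p * \<rr> + \<ll>" and "\<ll> < p"
    and "n = q * r + l" and "l < q"
  shows "(\<exists>b. recurrence_coeffs p q \<beta> B n b) \<and>
    (\<forall>b. recurrence_coeffs p q \<beta> B n b \<longrightarrow>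
      (\<forall>j\<in>{1..q}. b (int j) =
        kappa_hat p q \<alpha> \<beta> (n + j) / kappa_hat p q \<alpha> \<beta> n
        * (\<Prod>a=1..p.
             ipochhammer (\<alpha> a + \<beta> (l + 1 + j) + real r + 1 + real \<rr>)
               \<lceil>(real \<ll> + real j + 2 - real a) / real p\<rceil>
             / ipochhammer (\<alpha> a + \<beta> (l + 1 + j) + real r + 1 + real \<rr>)
               \<lceil>(real \<ll> + real j + 1 - real a) / real p\<rceil>)
        * (\<Sum>k=j..q.
             (\<Prod>a=1..\<ll>. \<alpha> a + \<beta> (k + l + 1) + real r)
             * (\<Prod>a=1..p.
                  pochhammer (\<alpha> (a + \<ll>) + \<beta> (k + l + 1) + real r) \<rr>
                  / ipochhammer (\<alpha> a + \<beta> (k + l + 1) + real r + 1)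
                      (int \<rr> + \<lceil>(real \<ll> + real j + 2 - real a) / real p\<rceil>))
             * ((\<Prod>h=1..q. \<beta> h - \<beta> (k + l + 1) - real r)
                / (\<Prod>h\<in>{j..q} - {k}. \<beta> (h + l + 1) - \<beta> (k + l + 1))))) \<and>
      b 0 =
        (\<Prod>h=1..q. (\<alpha> (\<ll> + 1) + \<beta> h + real \<rr> + 1)
                    / (\<alpha> (\<ll> + 1) + \<beta> (l + 1 + h) + real r + real \<rr> + 1))
        * (\<Prod>a=1..p. (\<alpha> a - \<alpha> (\<ll> + 1) - real \<rr> - 1)
                      / (\<alpha> (\<ll> + a) - \<alpha> (\<ll> + 1) - 1))
        + (\<Sum>k=1..p.
             (\<alpha> (\<ll> + 1) + \<beta> (l + 1) + real \<rr> + real r + 1)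
             / ((\<alpha> (\<ll> + k) + \<beta> (l + 1) + real \<rr> + real r)
                * (\<alpha> (\<ll> + 1) - \<alpha> (\<ll> + k) + 1))
             * (\<Prod>h=1..q. (\<alpha> (\<ll> + k) + \<beta> h + real \<rr>)
                           / (\<alpha> (\<ll> + k) + \<beta> (l + 1 + h) + real \<rr> + real r))
             * ((\<Prod>a=1..p. \<alpha> a - \<alpha> (\<ll> + k) - real \<rr>)
                / (\<Prod>a\<in>{1..p} - {k}. \<alpha> (\<ll> + a) - \<alpha> (\<ll> + k)))) \<and>
      (\<forall>i\<in>{1..min p n}. b (- int i) =
        kappa_hat p q \<alpha> \<beta> (n - i) / kappa_hat p q \<alpha> \<beta> n
        * (\<Prod>h=1..q.
             ipochhammer (\<alpha> (p + \<ll> - i + 1) + \<beta> h + real \<rr> + real r)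
               \<lceil>(real l + 2 - real i - real h) / real q\<rceil>
             / ipochhammer (\<alpha> (p + \<ll> - i + 1) + \<beta> h + real \<rr> + real r)
               \<lceil>(real l + 1 - real i - real h) / real q\<rceil>)
        * (\<Sum>k=i..p.
             (\<Prod>h=1..l + 1. 1 / (\<alpha> (p + \<ll> - k + 1) + \<beta> h + real \<rr> + 1))
             * ((\<Prod>h=1..q.
                   ipochhammer (\<alpha> (p + \<ll> - k + 1) + \<beta> h + real \<rr>)
                     (int r + \<lceil>(real l + 1 - real i - real h) / real q\<rceil>)
                   / pochhammer (\<alpha> (p + \<ll> - k + 1) + \<beta> (l + 1 + h) + real \<rr> + 1) r)
                * (\<Prod>a=1..p. \<alpha> a - \<alpha> (p + \<ll> - k + 1) - real \<rr>)
                / (\<Prod>a\<in>{i..p} - {k}.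
                     \<alpha> (p + \<ll> - a + 1) - \<alpha> (p + \<ll> - k + 1))))))"
proof -
  have shift_\<alpha>: "unit_shift p \<alpha>" by (rule unit_shiftI) (use assms in auto)
  have shift_\<beta>: "unit_shift q \<beta>" by (rule unit_shiftI) (use assms in auto)
  interpret stepline_parameters p q \<alpha> \<beta>
  proof
    show "inj_on \<alpha> {1..}" by (rule unit_shift_inj_on[OF \<open>p \<ge> 1\<close> shift_\<alpha>]) (use assms in auto)
    show "inj_on \<beta> {1..}" by (rule unit_shift_inj_on[OF \<open>q \<ge> 1\<close> shift_\<beta>]) (use assms in auto)
    fix i j :: nat assume i: "i \<ge> 1" and j: "j \<ge> 1"
    have "(i - 1) mod p + 1 \<in> {1..p}" "(j - 1) mod q + 1 \<in> {1..q}"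
      using assms(1,2) by (auto simp: Suc_leI)
    then have "\<alpha> ((i - 1) mod p + 1) + \<beta> ((j - 1) mod q + 1) > -1" by (rule assms(5))
    then show "\<alpha> i + \<beta> j > -1"
      using affine_index_mod_div[OF shift_\<alpha>, of "i - 1"] affine_index_mod_div[OF shift_\<beta>, of "j - 1"] i j
      by simp
  qed (use assms shift_\<alpha> shift_\<beta> in auto)
  note B = assms(10,11)
  note n_eq = assms(12-15)
  have expansion: "poly (shifted_numerator n) s = (\<Sum>N=n - min p n..n+q.
       (b (int N - int n) * mellin_const N)
       * ((\<Prod>i=n - min p n+1..N. s - \<alpha> i) * (\<Prod>j=N+2..n+q+1. s - node j)))"
    if "recurrence_coeffs p q \<beta> B n b" for b s
    using that recurrence_coeffs_iff[OF B, of n b] by blast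
  note up = coefficient_\<beta>_residues[OF refl expansion]
    and low = coefficient_\<alpha>_residues[OF refl expansion]
  have upper: "b (int j) = \<kappa> (n + j) / \<kappa> n
      * ((\<alpha> (n + j + 1) + \<beta> (n + j + 1) + 1) * (\<Sum>h=n+j+1..n+q+1. \<beta>_residue n (n + j) h))"
    (is "_ = _ * (?A * ?S)") if "recurrence_coeffs p q \<beta> B n b" "j \<in> {1..q}" for b j
  proof -
    have "b (int j) * mellin_const (n + j) = (-1) ^ j * ?A * mellin_const n * ?S"
      using up[OF that(1), of "n + j" j] that(2) by simp
    then have "b (int j) = (-1) ^ j * (mellin_const n / mellin_const (n + j)) * (?A * ?S)"
      using mellin_const_nonzero[of "n + j"] by (simp add: field_simps)
    also have "\<dots> = ((-1) ^ j * (-1) ^ (n + (n + j))) * (\<kappa> (n + j) / \<kappa> n * (?A * ?S))"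
      unfolding mellin_const_ratio by (simp only: mult_ac)
    \<comment> \<open>The sign of the divided difference cancels the sign in the ratio of Mellin
      constants, since the total exponent 2n + 2j is even.\<close>
    also have "(-1::real) ^ j * (-1) ^ (n + (n + j)) = 1"
      by (simp add: minus_one_power_iff)
    finally show ?thesis by simp
  qed
  have middle: "b 0 = (\<alpha> (n + 1) + \<beta> (n + 1) + 1) * (\<Sum>u=n+1..n+p+1. \<alpha>_residue n n u)"
    if "recurrence_coeffs p q \<beta> B n b" for b
    using low[OF that, of n] mellin_const_nonzero[of n] by simp
  have lower: "b (- int i) = \<kappa> (n - i) / \<kappa> n
      * ((-1) ^ i * (\<alpha> (n - i + 1) + \<beta> (n - i + 1) + 1) * (\<Sum>u=n+1..n-i+p+1. \<alpha>_residue n (n - i) u))"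
    (is "_ = _ * (_ * ?A * ?S)") if b: "recurrence_coeffs p q \<beta> B n b" and i: "i \<in> {1..min p n}" for b i
  proof -
    have "int (n - i) - int n = - int i" using i by simp
    moreover have "b (int (n - i) - int n) * mellin_const (n - i) = ?A * mellin_const n * ?S"
      by (rule low[OF b]) (use i in auto)
    ultimately have "b (- int i) * mellin_const (n - i) = ?A * mellin_const n * ?S" by simp
    then have "b (- int i) = (mellin_const n / mellin_const (n - i)) * (?A * ?S)"
      using mellin_const_nonzero[of "n - i"] by (simp add: field_simps)
    moreover have "(-1::real) ^ (n + (n - i)) = (-1) ^ i"
      using i by (simp add: minus_one_power_iff)
    ultimately show ?thesis unfolding mellin_const_ratio by (simp only: mult_ac)
  qed
  show ?thesis
  proof (intro conjI allI impI ballI, goal_cases)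
    case 1
    show ?case by (rule ex_recurrence_coeffs[OF B])
  next
    case (2 b j)
    then show ?case using upper[of b j] upper_coefficient[OF n_eq, of j] by (simp only: mult.assoc)
  next
    case (3 b)
    then show ?case using middle[of b] middle_coefficient[OF n_eq] by (simp only:)
  next
    case (4 b i)
    then show ?case using lower[of b i] lower_coefficient[OF n_eq, of i] by (simp only: mult.assoc)
  qed
qed

end
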